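(* Assume the auxiliary variables are continuous, i.e. $\mathcal A\subseteq\mathbb R^{d_a}$ is regular closed ($\overline{\mathcal A^\circ}=\mathcal A$). Let $\theta=(f,p,G)$ and $\hat\theta=(\hat f,\hat p,\hat G)$ be two graphical latent models whose factors $p(z_i^t\mid z^{<t},a^{<t})$ and $\hat p(z_i^t\mid z^{<t},a^{<t})$ are, for every $t\in[T]$ and $i\in[d_z]$, $C^2$ functions on $\mathbb R\times\mathbb R^{d_z\times(t-1)}\times\mathcal A^t$. Assume: 1. (Observational equivalence) $\theta\sim_{\rm obs}\hat\theta$. 2. (Sufficient influence of $a$) For Lebesgue-almost every $z\in\mathbb R^{d_z}$ and every $\ell\in[d_a]$ there exist tuples $(t_{(r)},\tau_{(r)},z_{(r)},a_{(r)})$, $r=1,\dots,|\mathrm{Ch}^a_\ell|$, with $t_{(r)}\in[T]$, $0\le\tau_{(r)}<t_{(r)}$, $z_{(r)}\in\mathbb R^{d_z\times(t_{(r)}-1)}$, $a_{(r)}\in\mathcal A^{t_{(r)}}$, such that $$\mathrm{span}\Big\{\big(H^{t_{(r)},\tau_{(r)}}_{z,a}\log p(z\mid z_{(r)},a_{(r)})\big)_{\cdot,\ell}\Big\}_{r=1}^{|\mathrm{Ch}^a_\ell|}=\mathbb R^{d_z}_{\mathrm{Ch}^a_\ell}.$$ Then there exists a $d_z\times d_z$ permutation matrix $P$ such that $PG^a\subseteq\hat G^a$. If in addition 3. (Sparsity) $\|\hat G^a\|_0\le\|G^a\|_0$, then $\theta\sim^{a}_{\rm con}\hat\theta$ ($\theta$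 and $\hat\theta$ are $a$-consistent).
   Context: **Notation.** $[n]=\{1,\dots,n\}$. Fix positive integers $T,d_x,d_z,d_a$ with $d_z\le d_x$, a constant $\sigma^2\ge0$ and a nonempty set $\mathcal A\subseteq\mathbb R^{d_a}$. Write $z^{<t}=(z^1,\dots,z^{t-1})\in\mathbb R^{d_z\times(t-1)}$ and $a^{<t}=(a^0,\dots,a^{t-1})\in\mathcal A^t$ (columns indexed by time). For binary matrices, $A\subseteq B$ means every nonzero position of $A$ is a nonzero position of $B$; $\|A\|_0$ is the number of nonzero entries. For $S\subseteq[m]$, $\mathbb R^m_S=\{x\in\mathbb R^m: x_i=0\ \forall i\notin S\}$. For $B\in\{0,1\}^{m\times n}$, $\mathbb R^{m\times n}_B=\{M\in\mathbb R^{m\times n}:B_{i,j}=0\Rightarrow M_{i,j}=0\}$. A map defined on an arbitrary subset of $\mathbb R^n$ is $C^k$ if it extends to a $C^k$ map on an open set containing that subset (on a regular closed set its first $k$ derivatives do not depend on the extension). A diffeomorphism is a $C^1$ bijection with $C^1$ inverse. A permutation matrix is identified with the linear map it defines. **Graphical latent model.** A triple $\theta=(f,p,G)$, $G=[G^z,G^a]$, $G^z\in\{0,1\}^{d_z\times d_z}$, $G^a\in\{0,1\}^{d_z\times d_a}$, such that: (i) $f:\mathbb R^{d_z}\to\mathbb R^{d_x}$ is a diffeomorphism onto its image, and $f(\mathbb R^{d_z})$ is closed in $\mathbb R^{d_x}$; observations are $x^t=f(z^t)+n^t$, $t\in[T]$, where the $n^t\sim\mathcal N(0,\sigma^2I)$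 are independent across time and independent of all $z$'s and $a$'s; (ii) for each $t\in[T]$, the latent vector $z^t$ has, given $z^{<t}$ and $a^{<t}$, a conditional density with respect to Lebesgue measure $p(z^t\mid z^{<t},a^{<t})=\prod_{i=1}^{d_z}p(z^t_i\mid z^{<t},a^{<t})$, each factor being strictly positive on $\mathbb R$ (for $t=1$ the conditioning is on $a^0$ only); (iii) for each $i$ and $t$, $p(z^t_i\mid z^{<t},a^{<t})$ depends on $(z^{<t},a^{<t})$ only through the rows $z_j^{<t}$ with $G^z_{i,j}=1$ and the rows $a_\ell^{<t}$ with $G^a_{i,\ell}=1$. $\mathrm{Ch}^a_\ell=\{i\in[d_z]:G^a_{i,\ell}=1\}$. **Hessian.** $H^{t,\tau}_{z,a}\log p(z^t\mid z^{<t},a^{<t})\in\mathbb R^{d_z\times d_a}$ is the matrix with $(i,\ell)$ entry $\frac{\partial^2}{\partial a^\tau_\ell\,\partial z^t_i}\log p(z^t\mid z^{<t},a^{<t})$; subscript $\cdot,\ell$ denotes the $\ell$-th column. **Observational equivalence.** $\theta\sim_{\rm obs}\tilde\theta$ iff for every $a^{<T}\in\mathcal A^T$ the conditional distributions of $(x^1,\dots,x^T)$ given $a^{<T}$ induced by $\theta$ and $\tilde\theta$ (same $\sigma^2$) coincide. **Equivalence up to diffeomorphism.** $\theta\sim_{\rm diff}\tilde\theta$ iff $f(\mathbb R^{d_z})=\tilde f(\mathbb R^{d_z})$ and, with $v:=f^{-1}\circ\tilde f$ (the entanglement map, a diffeomorphism of $\mathbb R^{d_z}$), for all $t\in[T]$,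 $a^{<t}\in\mathcal A^t$, $z^{\le t}\in\mathbb R^{d_z\times t}$: $\tilde p(z^t\mid z^{<t},a^{<t})=p(v(z^t)\mid v(z^{<t}),a^{<t})\,|\det Dv(z^t)|$, where $v$ is applied columnwise to $z^{<t}$. **Dependency graph and $G$-preservation.** The dependency graph of $h:\mathbb R^n\to\mathbb R^m$ is $H\in\{0,1\}^{m\times n}$ with $H_{i,j}=0$ iff $h_i$ does not depend on its $j$-th argument (i.e. $h_i(a)=\bar h_i(a_{-j})$ for all $a$ for some function $\bar h_i$ of the remaining coordinates). For $B\in\{0,1\}^{m\times n}$, a matrix $C\in\mathbb R^{m\times m}$ is $B$-preserving if $C^\top\mathbb R^{m\times n}_B\subseteq\mathbb R^{m\times n}_B$; a function $c:\mathbb R^m\to\mathbb R^m$ is $B$-preserving if its dependency graph is a $B$-preserving matrix. **$a$-consistency.** $\theta\sim^a_{\rm con}\tilde\theta$ iff there is a permutation matrix $P$ such that $\theta\sim_{\rm diff}\tilde\theta$, $\tilde G^a=PG^a$, and $v=f^{-1}\circ\tilde f$ can be written $v=c\circ P^\top$ with $c$ a $G^a$-preserving diffeomorphism. *)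

theory Defs
  imports "HOL-Probability.Probability"
begin

section \<open>Functions of class C-k\<close>

text \<open>
  On an open set, \<open>f\<close> is of class C-(k+1) iff it is differentiable there and all its partial
  derivatives are of class C-k.
\<close>

primrec Ck_open :: "nat \<Rightarrow> 'a::euclidean_space set \<Rightarrow> ('a \<Rightarrow> 'b::real_normed_vector) \<Rightarrow> bool" where
  "Ck_open 0 U f \<longleftrightarrow> continuous_on U f"
| "Ck_open (Suc k) U f \<longleftrightarrow> (\<forall>x\<in>U. f differentiable (at x)) \<and>
     (\<forall>b\<in>Basis. Ck_open k U (\<lambda>x. frechet_derivative f (at x) b))"

definition Ck_extension ::
  "nat \<Rightarrow> 'a::euclidean_space set \<Rightarrow> ('a \<Rightarrow> 'b::real_normed_vector) \<Rightarrow> ('a \<Rightarrow> 'b) \<Rightarrow> bool" where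
  "Ck_extension k S f F \<longleftrightarrow>
     (\<exists>U. open U \<and> S \<subseteq> U \<and> Ck_open k U F) \<and> (\<forall>x\<in>S. F x = f x)"

definition Ck_on :: "nat \<Rightarrow> 'a::euclidean_space set \<Rightarrow> ('a \<Rightarrow> 'b::real_normed_vector) \<Rightarrow> bool" where
  "Ck_on k S f \<longleftrightarrow> (\<exists>F. Ck_extension k S f F)"

text \<open>
  The mixed second derivative (first in direction \<open>v\<close>, then in direction \<open>w\<close>) at a point of a set
  \<open>S\<close> that need not be open is that of a C-2 extension. If \<open>S\<close> is regular closed and \<open>f\<close> is of
  class C-2 on \<open>S\<close>, the value at points of \<open>S\<close> is the same for all such extensions.
\<close>

definition second_deriv_on ::
  "'a::euclidean_space set \<Rightarrow> ('a \<Rightarrow> real) \<Rightarrow> 'a \<Rightarrow> 'a \<Rightarrow> 'a \<Rightarrow> real" where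
  "second_deriv_on S f w v x =
     (let F = (SOME F. Ck_extension 2 S f F)
      in frechet_derivative (\<lambda>y. frechet_derivative F (at y) v) (at x) w)"

definition diffeo_onto_image ::
  "('a::euclidean_space \<Rightarrow> 'b::euclidean_space) \<Rightarrow> bool" where
  "diffeo_onto_image f \<longleftrightarrow> inj f \<and> Ck_on 1 UNIV f \<and> Ck_on 1 (range f) (inv f)"

definition diffeomorphism :: "('a::euclidean_space \<Rightarrow> 'a) \<Rightarrow> bool" where
  "diffeomorphism f \<longleftrightarrow> bij f \<and> Ck_on 1 UNIV f \<and> Ck_on 1 UNIV (inv f)"

definition regular_closed :: "'a::topological_space set \<Rightarrow> bool" where
  "regular_closed S \<longleftrightarrow> closure (interior S) = S"


section \<open>Binary matrices, dependency graphs, preservation\<close>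

definition binary_matrix :: "real^'n^'m \<Rightarrow> bool" where
  "binary_matrix M \<longleftrightarrow> (\<forall>i j. M $ i $ j = 0 \<or> M $ i $ j = 1)"

definition pattern_le :: "real^'n^'m \<Rightarrow> real^'n^'m \<Rightarrow> bool" where
  "pattern_le M N \<longleftrightarrow> (\<forall>i j. M $ i $ j \<noteq> 0 \<longrightarrow> N $ i $ j \<noteq> 0)"

definition l0_norm :: "real^'n^'m \<Rightarrow> nat" where
  "l0_norm M = card {(i, j). M $ i $ j \<noteq> 0}"

definition permutation_matrix :: "real^'n^'n \<Rightarrow> bool" where
  "permutation_matrix P \<longleftrightarrow> (\<exists>\<pi>. bij \<pi> \<and> P = (\<chi> i j. if i = \<pi> j then 1 else 0))"

definition coord_subspace :: "'m set \<Rightarrow> (real^'m) set" where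
  "coord_subspace S = {x. \<forall>i. i \<notin> S \<longrightarrow> x $ i = 0}"

definition matrices_with_pattern :: "real^'n^'m \<Rightarrow> (real^'n^'m) set" where
  "matrices_with_pattern B = {M. \<forall>i j. B $ i $ j = 0 \<longrightarrow> M $ i $ j = 0}"

definition matrix_preserving :: "real^'n^'m \<Rightarrow> real^'m^'m \<Rightarrow> bool" where
  "matrix_preserving B C \<longleftrightarrow>
     (\<lambda>M. transpose C ** M) ` matrices_with_pattern B \<subseteq> matrices_with_pattern B"

definition independent_of_arg :: "(real^'n \<Rightarrow> real) \<Rightarrow> 'n \<Rightarrow> bool" where
  "independent_of_arg h j \<longleftrightarrow> (\<forall>a b. (\<forall>k. k \<noteq> j \<longrightarrow> a $ k = b $ k) \<longrightarrow> h a = h b)"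

definition dependency_graph :: "(real^'n \<Rightarrow> real^'m) \<Rightarrow> real^'n^'m" where
  "dependency_graph h = (\<chi> i j. if independent_of_arg (\<lambda>x. h x $ i) j then 0 else 1)"

definition fun_preserving :: "real^'n^'m \<Rightarrow> (real^'m \<Rightarrow> real^'m) \<Rightarrow> bool" where
  "fun_preserving B c \<longleftrightarrow> matrix_preserving B (dependency_graph c)"


section \<open>Graphical latent models\<close>

text \<open>
  The index types \<open>'x\<close>, \<open>'z\<close>, \<open>'a\<close> have d_x, d_z, d_a elements. The set of times 1, ..., T is a finite
  linearly ordered type \<open>'t\<close> with T elements. Trajectories are full sequences of columns indexed by
  \<open>'t\<close>. For latents, noise and observations, the k-th element of \<open>'t\<close> stands for time k. For auxiliary
  variables, whose times are 0, ..., T-1, it stands for time k-1: the component \<open>as $ s\<close> is the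
  auxiliary vector that immediately precedes the latent \<open>zs $ s\<close>. Hence the latent history before
  \<open>t\<close> consists of the components \<open>s < t\<close>, the auxiliary history before \<open>t\<close> (which starts at time 0)
  consists of the components \<open>s \<le> t\<close>, and an auxiliary time tau satisfies 0 \<le> tau < t iff its
  index satisfies \<open>s \<le> t\<close>.

  \<open>dens \<theta> t i y zs as\<close> is the value at \<open>y\<close> of the conditional density of the i-th latent coordinate at
  time \<open>t\<close>. It is given whole trajectories; the definition of a model below makes it a function of the
  histories before \<open>t\<close> only.
\<close>

record ('x, 'z, 'a, 't) glm =
  mixing :: "real^'z \<Rightarrow> real^'x"
  dens :: "'t \<Rightarrow> 'z \<Rightarrow> real \<Rightarrow> real^'z^'t \<Rightarrow> real^'a^'t \<Rightarrow> real"
  Gz :: "real^'z^'z"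
  Ga :: "real^'a^'z"

text \<open>Trajectories whose auxiliary history before \<open>t\<close> lies in \<open>A\<close>.\<close>

definition aux_hist :: "(real^'a) set \<Rightarrow> 't \<Rightarrow> (real^'a^'t::{finite,linorder}) set" where
  "aux_hist A t = {as. \<forall>s\<le>t. as $ s \<in> A}"

definition graphical_latent_model ::
  "(real^'a) set \<Rightarrow> ('x::finite, 'z::finite, 'a::finite, 't::{finite,linorder}) glm \<Rightarrow> bool" where
  "graphical_latent_model A \<theta> \<longleftrightarrow>
     binary_matrix (Gz \<theta>) \<and> binary_matrix (Ga \<theta>) \<and>
     diffeo_onto_image (mixing \<theta>) \<and> closed (range (mixing \<theta>)) \<and>
     (\<forall>t i. \<forall>as \<in> aux_hist A t.
        (\<lambda>(y, zs). dens \<theta> t i y zs as) \<in> borel_measurable borel \<and>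
        (\<forall>zs. (\<forall>y. dens \<theta> t i y zs as > 0) \<and>
              (\<integral>\<^sup>+ y. ennreal (dens \<theta> t i y zs as) \<partial>lborel) = 1)) \<and>
     (\<forall>t i zs zs'. \<forall>as \<in> aux_hist A t. \<forall>as' \<in> aux_hist A t.
        (\<forall>j. Gz \<theta> $ i $ j = 1 \<longrightarrow> (\<forall>s<t. zs $ s $ j = zs' $ s $ j)) \<longrightarrow>
        (\<forall>l. Ga \<theta> $ i $ l = 1 \<longrightarrow> (\<forall>s\<le>t. as $ s $ l = as' $ s $ l)) \<longrightarrow>
        (\<forall>y. dens \<theta> t i y zs as = dens \<theta> t i y zs' as'))"

definition trans_dens ::
  "('x::finite, 'z::finite, 'a::finite, 't::finite) glm \<Rightarrow>
     't \<Rightarrow> real^'z \<Rightarrow> real^'z^'t \<Rightarrow> real^'a^'t \<Rightarrow> real" where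
  "trans_dens \<theta> t z zs as = (\<Prod>i\<in>UNIV. dens \<theta> t i (z $ i) zs as)"

definition Ch_a :: "('x::finite, 'z::finite, 'a::finite, 't::finite) glm \<Rightarrow> 'a \<Rightarrow> 'z set" where
  "Ch_a \<theta> l = {i. Ga \<theta> $ i $ l = 1}"

definition C2_factors ::
  "(real^'a) set \<Rightarrow> ('x::finite, 'z::finite, 'a::finite, 't::{finite,linorder}) glm \<Rightarrow> bool" where
  "C2_factors A \<theta> \<longleftrightarrow>
     (\<forall>t i. Ck_on 2 (UNIV \<times> UNIV \<times> aux_hist A t) (\<lambda>(y, zs, as). dens \<theta> t i y zs as))"

definition hessian_za ::
  "(real^'a) set \<Rightarrow> ('x::finite, 'z::finite, 'a::finite, 't::{finite,linorder}) glm \<Rightarrow>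
     't \<Rightarrow> 't \<Rightarrow> real^'z \<Rightarrow> real^'z^'t::{finite,linorder} \<Rightarrow> real^'a^'t::{finite,linorder} \<Rightarrow>
     real^'a^'z" where
  "hessian_za A \<theta> t s z zs as = (\<chi> i l.
     second_deriv_on (UNIV \<times> UNIV \<times> aux_hist A t) (\<lambda>(z, zs, as). ln (trans_dens \<theta> t z zs as))
       (0, 0, axis s (axis l 1)) (axis i 1, 0, 0) (z, zs, as))"


section \<open>Observational equivalence\<close>

text \<open>The law of the latent trajectory given the auxiliary trajectory, by the chain rule.\<close>

definition latent_law ::
  "('x::finite, 'z::finite, 'a::finite, 't::finite) glm \<Rightarrow> real^'a^'t \<Rightarrow> (real^'z^'t) measure" where
  "latent_law \<theta> as = density lborel (\<lambda>zs. ennreal (\<Prod>t\<in>UNIV. trans_dens \<theta> t (zs $ t) zs as))"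

text \<open>
  The noise at each time is \<open>sqrt \<sigma>2\<close> times a standard Gaussian vector; this covers \<open>\<sigma>2 = 0\<close>, where
  it vanishes.
\<close>

definition std_noise :: "(real^'x^'t) measure" where
  "std_noise = density lborel
     (\<lambda>n. ennreal (\<Prod>t\<in>UNIV. \<Prod>k\<in>UNIV. std_normal_density (n $ t $ k)))"

definition obs_law ::
  "real \<Rightarrow> ('x::finite, 'z::finite, 'a::finite, 't::finite) glm \<Rightarrow> real^'a^'t \<Rightarrow>
     (real^'x^'t) measure" where
  "obs_law \<sigma>2 \<theta> as =
     distr (latent_law \<theta> as \<Otimes>\<^sub>M std_noise) borel
       (\<lambda>(zs, n). \<chi> t. mixing \<theta> (zs $ t) + sqrt \<sigma>2 *\<^sub>R n $ t)"

definition obs_equiv ::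
  "(real^'a) set \<Rightarrow> real \<Rightarrow> ('x::finite, 'z::finite, 'a::finite, 't::finite) glm \<Rightarrow>
     ('x, 'z, 'a, 't) glm \<Rightarrow> bool" where
  "obs_equiv A \<sigma>2 \<theta> \<theta>' \<longleftrightarrow> (\<forall>as. (\<forall>s. as $ s \<in> A) \<longrightarrow> obs_law \<sigma>2 \<theta> as = obs_law \<sigma>2 \<theta>' as)"


section \<open>Equivalence up to diffeomorphism and a-consistency\<close>

definition entanglement_map ::
  "('x::finite, 'z::finite, 'a::finite, 't::finite) glm \<Rightarrow> ('x, 'z, 'a, 't) glm \<Rightarrow>
     real^'z \<Rightarrow> real^'z" where
  "entanglement_map \<theta> \<theta>' = inv (mixing \<theta>) \<circ> mixing \<theta>'"

definition diff_equiv ::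
  "(real^'a) set \<Rightarrow> ('x::finite, 'z::finite, 'a::finite, 't::{finite,linorder}) glm \<Rightarrow>
     ('x, 'z, 'a, 't) glm \<Rightarrow> bool" where
  "diff_equiv A \<theta> \<theta>' \<longleftrightarrow> range (mixing \<theta>) = range (mixing \<theta>') \<and>
     (let v = entanglement_map \<theta> \<theta>' in
       \<forall>t z zs. \<forall>as \<in> aux_hist A t.
         trans_dens \<theta>' t z zs as =
           trans_dens \<theta> t (v z) (\<chi> s. v (zs $ s)) as * \<bar>det (jacobian v (at z))\<bar>)"

definition a_consistent ::
  "(real^'a) set \<Rightarrow> ('x::finite, 'z::finite, 'a::finite, 't::{finite,linorder}) glm \<Rightarrow>
     ('x, 'z, 'a, 't) glm \<Rightarrow> bool" where
  "a_consistent A \<theta> \<theta>' \<longleftrightarrow> (\<exists>P. permutation_matrix P \<and> diff_equiv A \<theta> \<theta>' \<and>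
     Ga \<theta>' = P ** Ga \<theta> \<and>
     (\<exists>c. diffeomorphism c \<and> fun_preserving (Ga \<theta>) c \<and>
          entanglement_map \<theta> \<theta>' = c \<circ> (\<lambda>z. transpose P *v z)))"


section \<open>Sufficient influence of the auxiliary variables\<close>

definition sufficient_influence ::
  "(real^'a) set \<Rightarrow> ('x::finite, 'z::finite, 'a::finite, 't::{finite,linorder}) glm \<Rightarrow> bool" where
  "sufficient_influence A \<theta> \<longleftrightarrow>
     (AE z in lebesgue. \<forall>l. \<exists>t s zs as.
        (\<forall>r\<in>{1..card (Ch_a \<theta> l)}. s r \<le> t r \<and> as r \<in> aux_hist A (t r)) \<and>
        span ((\<lambda>r. column l (hessian_za A \<theta> (t r) (s r) z (zs r) (as r)))
                ` {1..card (Ch_a \<theta> l)}) = coord_subspace (Ch_a \<theta> l))"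

end

theory Submission
  imports Defs
begin

text \<open>
  Dividing characteristic functions removes the Gaussian noise, so the laws of the noiseless
  observations agree. As the latent densities are positive and the ranges of the mixing functions
  closed, these ranges coincide, and the entanglement map \<open>v\<close> is a diffeomorphism. Changing variables
  and integrating out the latents from the last time backwards then identifies each transition
  density up to \<open>v\<close>.

  Differentiating the resulting identity for log densities in \<open>z $ j\<close> and in the auxiliary variable
  \<open>l\<close> shows that, if \<open>l\<close> does not influence \<open>j\<close> in the second model, the \<open>j\<close>-th column of the Jacobian
  of \<open>v\<close> is orthogonal to the \<open>l\<close>-th Hessian column of the first model. By sufficient influence and
  continuity, the \<open>(i, j)\<close> entry of the Jacobian vanishes identically for every \<open>i\<close> that \<open>l\<close> influences
  in the first model. A nonvanishing term in the Leibniz expansion of the determinant of the Jacobian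
  at one point supplies the permutation.
\<close>

section \<open>Characteristic functions on Euclidean spaces\<close>

text \<open>The Gaussian characteristic function has no zeros, so the division loses no information;
  for zero noise variance it is constantly 1. Laws determine densities only almost everywhere, and
  the C-2 hypothesis lifts the identity of joint densities to every point, since both sides are
  continuous.

  The zeros of the Jacobian that the graphs force hold at all points, so a single point suffices for
  the permutation: there some product over the entries \<open>(p j, j)\<close> is nonzero. If
  \<open>l\<close> influenced \<open>p j\<close> in the first model but not \<open>j\<close> in the
  second, one of these entries would be 0; hence the inclusion of graphs. Under the sparsity bound
  the two supports, nested and finite, coincide. The forced zeros are then read a second time: after
  a permutation of its arguments, \<open>v\<close> has a dependency graph that preserves the graph
  of the first model.\<close>

definition std_gaussian :: "'a::euclidean_space measure" where
  "std_gaussian = density lborel (\<lambda>x. ennreal (\<Prod>b\<in>Basis. std_normal_density (x \<bullet> b)))"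

lemma space_std_gaussian [simp]: "space std_gaussian = UNIV"
  and sets_std_gaussian [simp, measurable_cong]: "sets std_gaussian = sets borel"
  by (auto simp: std_gaussian_def)

lemma prob_space_std_gaussian: "prob_space (std_gaussian :: 'a::euclidean_space measure)"
proof
  have "emeasure (std_gaussian :: 'a measure) (space std_gaussian)
      = (\<integral>\<^sup>+ x. (\<Prod>b\<in>Basis. ennreal (std_normal_density ((x::'a) \<bullet> b))) \<partial>lborel)"
    by (simp add: std_gaussian_def emeasure_density prod_ennreal)
  also have "\<dots> = (\<Prod>b\<in>(Basis::'a set). \<integral>\<^sup>+ x. ennreal (std_normal_density x) \<partial>lborel)"
    by (rule nn_integral_lborel_prod) auto
  also have "(\<integral>\<^sup>+ x. ennreal (std_normal_density x) \<partial>lborel) = 1"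
    using prob_space.emeasure_space_1[OF prob_space_normal_density[of 1 0]]
    by (simp add: emeasure_density)
  finally show "emeasure (std_gaussian :: 'a measure) (space std_gaussian) = 1" by simp
qed

lemma prod_std_normal_density:
  fixes x :: "'a::euclidean_space"
  shows "(\<Prod>b\<in>Basis. std_normal_density (x \<bullet> b)) = (1 / sqrt (2 * pi)) ^ DIM('a) * exp (- (norm x)\<^sup>2 / 2)"
proof -
  have "(\<Prod>b\<in>Basis. std_normal_density (x \<bullet> b))
      = (1 / sqrt (2 * pi)) ^ DIM('a) * exp (\<Sum>b\<in>Basis. - (x \<bullet> b)\<^sup>2 / 2)"
    by (simp add: std_normal_density_def prod.distrib exp_sum prod_dividef power_divide)
  also have "(\<Sum>b\<in>Basis. - (x \<bullet> b)\<^sup>2 / 2) = - (norm x)\<^sup>2 / 2"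
    unfolding power2_norm_eq_inner
    by (subst euclidean_inner) (simp add: power2_eq_square sum_negf flip: sum_divide_distrib)
  finally show ?thesis .
qed

text \<open>\<open>iexp (s \<bullet> x)\<close> factors over the coordinates, so Fubini reduces the
  integral to the one-dimensional formula. The result serves twice: it writes Gaussian averages
  through characteristic functions, and it gives the factor contributed by the noise.\<close>

lemma char_std_gaussian:
  fixes s :: "'a::euclidean_space"
  shows "(\<integral>x. iexp (s \<bullet> x) \<partial>std_gaussian) = complex_of_real (exp (- (norm s)\<^sup>2 / 2))"
proof -
  interpret product_sigma_finite "\<lambda>_::'a. lborel :: real measure" ..
  interpret N: prob_space std_normal_distribution
    by (rule prob_space_normal_density) simp
  let ?g = "\<lambda>b y. std_normal_density y *\<^sub>R iexp ((s \<bullet> b) * y)"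
  have int: "integrable lborel (?g b)" for b
  proof -
    have "integrable std_normal_distribution (\<lambda>y. iexp ((s \<bullet> b) * y))"
      by (rule N.integrable_iexp) auto
    then show ?thesis
      by (subst (asm) integrable_density) auto
  qed
  have char: "(\<integral>y. ?g b y \<partial>lborel) = complex_of_real (exp (- (s \<bullet> b)\<^sup>2 / 2))" for b
    using fun_cong[OF char_std_normal_distribution, of "s \<bullet> b"]
    unfolding char_def by (subst (asm) integral_density) auto
  have eq: "(\<Prod>b\<in>Basis. std_normal_density ((\<Sum>c\<in>Basis. f c *\<^sub>R c) \<bullet> b)) *\<^sub>R iexp (s \<bullet> (\<Sum>c\<in>Basis. f c *\<^sub>R c))
      = (\<Prod>b\<in>Basis. ?g b (f b))" for f :: "'a \<Rightarrow> real"
    by (simp add: scaleR_conv_of_real prod.distrib exp_sum inner_sum_right sum_distrib_left mult_ac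
        flip: of_real_prod)
  have "(\<integral>x. iexp (s \<bullet> x) \<partial>std_gaussian)
      = (\<integral>x. (\<Prod>b\<in>Basis. std_normal_density (x \<bullet> b)) *\<^sub>R iexp (s \<bullet> x) \<partial>lborel)"
    unfolding std_gaussian_def
    by (subst integral_density) (auto intro!: prod_nonneg)
  also have "\<dots> = (\<integral>f. (\<Prod>b\<in>Basis. ?g b (f b)) \<partial>(\<Pi>\<^sub>M b\<in>(Basis::'a set). lborel))"
    by (subst lborel_eq, subst integral_distr) (measurable, simp only: eq)
  also have "\<dots> = (\<Prod>b\<in>Basis. \<integral>y. ?g b y \<partial>lborel)"
    by (rule product_integral_prod) (use int in auto)
  also have "\<dots> = complex_of_real (exp (\<Sum>b\<in>Basis. - (s \<bullet> b)\<^sup>2 / 2))"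
    by (simp only: char exp_sum[OF finite_Basis] of_real_prod)
  also have "(\<Sum>b\<in>Basis. - (s \<bullet> b)\<^sup>2 / 2) = - (norm s)\<^sup>2 / 2"
    unfolding power2_norm_eq_inner
    by (subst euclidean_inner) (simp add: power2_eq_square sum_negf flip: sum_divide_distrib)
  finally show ?thesis .
qed

text \<open>Parseval's identity for the Gaussian kernel: the kernel is a characteristic function of
  \<open>std_gaussian\<close>, and the two integrals are exchanged. The right-hand side involves
  \<open>M\<close> through its characteristic function only.\<close>

lemma gaussian_average_char:
  fixes M :: "'a::euclidean_space measure" and y :: 'a and k :: real
  assumes M: "prob_space M" and [measurable_cong]: "sets M = sets borel"
  shows "complex_of_real (\<integral>x. exp (- (norm (k *\<^sub>R (x - y)))\<^sup>2 / 2) \<partial>M)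
    = (\<integral>s. iexp (- ((k *\<^sub>R y) \<bullet> s)) * (\<integral>x. iexp ((k *\<^sub>R s) \<bullet> x) \<partial>M) \<partial>std_gaussian)"
proof -
  interpret M: prob_space M by fact
  interpret G: prob_space "std_gaussian :: 'a measure" by (rule prob_space_std_gaussian)
  interpret P: pair_prob_space M "std_gaussian :: 'a measure" ..
  have int: "integrable (M \<Otimes>\<^sub>M std_gaussian) (\<lambda>(x, s). iexp ((k *\<^sub>R (x - y)) \<bullet> s))"
    unfolding split_def by (rule P.integrable_iexp) auto
  have "complex_of_real (\<integral>x. exp (- (norm (k *\<^sub>R (x - y)))\<^sup>2 / 2) \<partial>M)
      = (\<integral>x. (\<integral>s. iexp ((k *\<^sub>R (x - y)) \<bullet> s) \<partial>std_gaussian) \<partial>M)"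
    by (simp only: char_std_gaussian integral_complex_of_real)
  also have "\<dots> = (\<integral>s. (\<integral>x. iexp ((k *\<^sub>R (x - y)) \<bullet> s) \<partial>M) \<partial>std_gaussian)"
    by (rule P.Fubini_integral[OF int, symmetric])
  also have "\<dots> = (\<integral>s. (\<integral>x. iexp (- ((k *\<^sub>R y) \<bullet> s)) * iexp ((k *\<^sub>R s) \<bullet> x) \<partial>M) \<partial>std_gaussian)"
    by (simp add: exp_add[symmetric] algebra_simps inner_diff_left inner_commute)
  also have "\<dots> = (\<integral>s. iexp (- ((k *\<^sub>R y) \<bullet> s)) * (\<integral>x. iexp ((k *\<^sub>R s) \<bullet> x) \<partial>M) \<partial>std_gaussian)"
    by simp
  finally show ?thesis .
qed

text \<open>Convolution with a Gaussian of standard deviation \<open>1/k\<close> produces a density,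
  found by substituting \<open>y = x + w / k\<close> and exchanging integrals. Its value at
  \<open>y\<close> is a Gaussian average of \<open>M\<close>, hence determined by the characteristic
  function.\<close>

lemma nn_integral_gaussian_smoothing:
  fixes M :: "'a::euclidean_space measure" and h :: "'a \<Rightarrow> ennreal" and k :: real
  assumes M: "prob_space M" and sM[measurable_cong]: "sets M = sets borel"
    and k: "k > 0" and [measurable]: "h \<in> borel_measurable borel"
  shows "(\<integral>\<^sup>+x. \<integral>\<^sup>+w. h (x + (1/k) *\<^sub>R w) \<partial>std_gaussian \<partial>M)
    = (\<integral>\<^sup>+y. h y * ennreal (k ^ DIM('a) * (1 / sqrt (2 * pi)) ^ DIM('a) *
        (\<integral>x. exp (- (norm (k *\<^sub>R (x - y)))\<^sup>2 / 2) \<partial>M)) \<partial>lborel)"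
proof -
  interpret M: prob_space M by fact
  let ?c = "(1 / sqrt (2 * pi)) ^ DIM('a)"
  let ?F = "\<lambda>x y. h y * ennreal (k ^ DIM('a) * ?c * exp (- (norm (k *\<^sub>R (x - y)))\<^sup>2 / 2))"
  have inner: "(\<integral>\<^sup>+w. h (x + (1/k) *\<^sub>R w) \<partial>std_gaussian) = (\<integral>\<^sup>+y. ?F x y \<partial>lborel)" for x
  proof -
    have "(\<integral>\<^sup>+y. ?F x y \<partial>lborel)
        = (\<integral>\<^sup>+w. ennreal (\<bar>1/k\<bar> ^ DIM('a)) * ?F x (x + (1/k) *\<^sub>R w) \<partial>lborel)"
      using k by (subst lborel_affine[of "1/k" x]) (auto simp: nn_integral_density nn_integral_distr)
    also have "\<dots> = (\<integral>\<^sup>+w. ennreal (?c * exp (- (norm w)\<^sup>2 / 2)) * h (x + (1/k) *\<^sub>R w) \<partial>lborel)"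
    proof (rule nn_integral_cong)
      fix w :: 'a
      have "ennreal (\<bar>1/k\<bar> ^ DIM('a)) * ennreal (k ^ DIM('a) * ?c * exp (- (norm w)\<^sup>2 / 2))
          = ennreal (?c * exp (- (norm w)\<^sup>2 / 2))"
        using k by (subst ennreal_mult[symmetric]) (auto simp: power_divide)
      moreover have "norm (k *\<^sub>R (x - (x + (1/k) *\<^sub>R w))) = norm w"
        using k by simp
      ultimately show "ennreal (\<bar>1/k\<bar> ^ DIM('a)) * ?F x (x + (1/k) *\<^sub>R w)
          = ennreal (?c * exp (- (norm w)\<^sup>2 / 2)) * h (x + (1/k) *\<^sub>R w)"
        by (simp only: mult.left_commute[of _ "h _"]) (simp only: mult.commute)
    qed
    also have "\<dots> = (\<integral>\<^sup>+w. h (x + (1/k) *\<^sub>R w) \<partial>std_gaussian)"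
      unfolding std_gaussian_def prod_std_normal_density
      by (subst nn_integral_density) auto
    finally show ?thesis by simp
  qed
  interpret pair_sigma_finite M "lborel :: 'a measure" ..
  have "(\<integral>\<^sup>+x. \<integral>\<^sup>+w. h (x + (1/k) *\<^sub>R w) \<partial>std_gaussian \<partial>M) = (\<integral>\<^sup>+x. \<integral>\<^sup>+y. ?F x y \<partial>lborel \<partial>M)"
    by (simp add: inner)
  also have "\<dots> = (\<integral>\<^sup>+y. \<integral>\<^sup>+x. ?F x y \<partial>M \<partial>lborel)"
    by (rule Fubini'[symmetric]) measurable
  also have "\<dots> = (\<integral>\<^sup>+y. h y * ennreal (k ^ DIM('a) * ?c *
        (\<integral>x. exp (- (norm (k *\<^sub>R (x - y)))\<^sup>2 / 2) \<partial>M)) \<partial>lborel)"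
  proof (rule nn_integral_cong)
    fix y :: 'a
    have i: "integrable M (\<lambda>x. exp (- (norm (k *\<^sub>R (x - y)))\<^sup>2 / 2))"
      by (rule M.integrable_const_bound[of _ 1]) auto
    have "(\<integral>\<^sup>+x. ?F x y \<partial>M) = h y * (\<integral>\<^sup>+x. ennreal (k ^ DIM('a) * ?c * exp (- (norm (k *\<^sub>R (x - y)))\<^sup>2 / 2)) \<partial>M)"
      by (rule nn_integral_cmult) measurable
    also have "(\<integral>\<^sup>+x. ennreal (k ^ DIM('a) * ?c * exp (- (norm (k *\<^sub>R (x - y)))\<^sup>2 / 2)) \<partial>M)
        = ennreal (k ^ DIM('a) * ?c * (\<integral>x. exp (- (norm (k *\<^sub>R (x - y)))\<^sup>2 / 2) \<partial>M))"
      using k i by (subst nn_integral_eq_integral) auto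
    finally show "(\<integral>\<^sup>+x. ?F x y \<partial>M) = h y * ennreal (k ^ DIM('a) * ?c *
        (\<integral>x. exp (- (norm (k *\<^sub>R (x - y)))\<^sup>2 / 2) \<partial>M))" .
  qed
  finally show ?thesis .
qed

text \<open>Dominated convergence with the constant 1; the upper bound on \<open>h\<close> gives the
  domination, as \<open>ennreal\<close> cuts negative values off at 0.\<close>

lemma nn_integral_gaussian_smoothing_tendsto:
  fixes M :: "'a::euclidean_space measure" and h :: "'a \<Rightarrow> real"
  assumes M: "prob_space M" and sM[measurable_cong]: "sets M = sets borel"
    and h: "continuous_on UNIV h" "\<And>x. h x \<le> 1"
  shows "(\<lambda>n. \<integral>\<^sup>+x. \<integral>\<^sup>+w. ennreal (h (x + (1 / real (Suc n)) *\<^sub>R w)) \<partial>std_gaussian \<partial>M)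
    \<longlonglongrightarrow> (\<integral>\<^sup>+x. ennreal (h x) \<partial>M)"
proof -
  interpret M: prob_space M by fact
  interpret G: prob_space "std_gaussian :: 'a measure" by (rule prob_space_std_gaussian)
  interpret P: pair_prob_space M "std_gaussian :: 'a measure" ..
  have [measurable]: "h \<in> borel_measurable borel"
    using h(1) by (rule borel_measurable_continuous_onI)
  let ?u = "\<lambda>n (x, w). ennreal (h (x + (1 / real (Suc n)) *\<^sub>R w))"
  have "(\<lambda>n. \<integral>\<^sup>+p. ?u n p \<partial>(M \<Otimes>\<^sub>M std_gaussian)) \<longlonglongrightarrow> (\<integral>\<^sup>+p. ennreal (h (fst p)) \<partial>(M \<Otimes>\<^sub>M (std_gaussian :: 'a measure)))"
  proof (rule nn_integral_dominated_convergence[where w = "\<lambda>_. 1"])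
    show "AE p in M \<Otimes>\<^sub>M std_gaussian. (\<lambda>n. ?u n p) \<longlonglongrightarrow> ennreal (h (fst p))"
    proof (rule AE_I2)
      fix p :: "'a \<times> 'a"
      obtain x w where p: "p = (x, w)" by (cases p)
      have "(\<lambda>n. x + (1 / real (Suc n)) *\<^sub>R w) \<longlonglongrightarrow> x + 0 *\<^sub>R w"
        by (intro tendsto_intros LIMSEQ_Suc lim_1_over_n)
      moreover have "isCont h x" using h(1) by (simp add: continuous_on_eq_continuous_at)
      ultimately have "(\<lambda>n. h (x + (1 / real (Suc n)) *\<^sub>R w)) \<longlonglongrightarrow> h x"
        using isCont_tendsto_compose by fastforce
      then show "(\<lambda>n. ?u n p) \<longlonglongrightarrow> ennreal (h (fst p))"
        by (simp add: p tendsto_ennrealI)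
    qed
  qed (use h(2) in \<open>auto simp: P.emeasure_space_1 ennreal_le_1 split: prod.splits\<close>)
  moreover have "(\<integral>\<^sup>+p. ?u n p \<partial>(M \<Otimes>\<^sub>M std_gaussian))
      = (\<integral>\<^sup>+x. \<integral>\<^sup>+w. ennreal (h (x + (1 / real (Suc n)) *\<^sub>R w)) \<partial>std_gaussian \<partial>M)" for n
    by (subst G.nn_integral_fst[symmetric]) auto
  moreover have "(\<integral>\<^sup>+p. ennreal (h (fst p)) \<partial>(M \<Otimes>\<^sub>M (std_gaussian :: 'a measure))) = (\<integral>\<^sup>+x. ennreal (h x) \<partial>M)"
    by (subst G.nn_integral_fst[symmetric]) (use G.emeasure_space_1 in auto)
  ultimately show ?thesis by simp
qed

text \<open>Equal characteristic functions give equal Gaussian averages, hence equal integrals after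
  smoothing. Letting the width \<open>1 / Suc n\<close> shrink yields equal integrals of continuous
  functions bounded by 1, and these approximate the indicators of closed sets, an
  intersection-stable generator of the Borel sets.\<close>

theorem measure_eqI_char:
  fixes M N :: "'a::euclidean_space measure"
  assumes M: "prob_space M" "sets M = sets borel" and N: "prob_space N" "sets N = sets borel"
    and char: "\<And>s. (\<integral>x. iexp (s \<bullet> x) \<partial>M) = (\<integral>x. iexp (s \<bullet> x) \<partial>N)"
  shows "M = N"
proof -
  have K: "(\<integral>x. exp (- (norm (k *\<^sub>R (x - y)))\<^sup>2 / 2) \<partial>M) = (\<integral>x. exp (- (norm (k *\<^sub>R (x - y)))\<^sup>2 / 2) \<partial>N)"
    for k and y :: 'a
  proof -
    have "complex_of_real (\<integral>x. exp (- (norm (k *\<^sub>R (x - y)))\<^sup>2 / 2) \<partial>M)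
        = complex_of_real (\<integral>x. exp (- (norm (k *\<^sub>R (x - y)))\<^sup>2 / 2) \<partial>N)"
      unfolding gaussian_average_char[OF M] gaussian_average_char[OF N] char ..
    then show ?thesis by (simp only: of_real_eq_iff)
  qed
  have cont: "(\<integral>\<^sup>+x. ennreal (h x) \<partial>M) = (\<integral>\<^sup>+x. ennreal (h x) \<partial>N)"
    if h: "continuous_on UNIV h" "\<And>x. h x \<le> 1" for h :: "'a \<Rightarrow> real"
  proof (rule LIMSEQ_unique[OF nn_integral_gaussian_smoothing_tendsto[OF M h]])
    have m: "(\<lambda>x. ennreal (h x)) \<in> borel_measurable borel"
      using borel_measurable_continuous_onI[OF h(1)] by measurable
    have "(\<integral>\<^sup>+x. \<integral>\<^sup>+w. ennreal (h (x + (1 / real (Suc n)) *\<^sub>R w)) \<partial>std_gaussian \<partial>M)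
      = (\<integral>\<^sup>+x. \<integral>\<^sup>+w. ennreal (h (x + (1 / real (Suc n)) *\<^sub>R w)) \<partial>std_gaussian \<partial>N)" for n
      unfolding nn_integral_gaussian_smoothing[OF M of_nat_0_less_iff[THEN iffD2, OF zero_less_Suc] m]
        nn_integral_gaussian_smoothing[OF N of_nat_0_less_iff[THEN iffD2, OF zero_less_Suc] m] K ..
    then show "(\<lambda>n. \<integral>\<^sup>+x. \<integral>\<^sup>+w. ennreal (h (x + (1 / real (Suc n)) *\<^sub>R w)) \<partial>std_gaussian \<partial>M)
      \<longlonglongrightarrow> (\<integral>\<^sup>+x. ennreal (h x) \<partial>N)"
      using nn_integral_gaussian_smoothing_tendsto[OF N h] by simp
  qed
  \<comment> \<open>These continuous functions are 1 on \<open>C\<close> and decrease to 0 off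
    \<open>C\<close>, because closedness makes \<open>infdist x C\<close> positive for every
    \<open>x\<close> outside \<open>C\<close>.\<close>
  have lim: "(\<lambda>n. \<integral>\<^sup>+x. ennreal (max 0 (1 - real n * infdist x C)) \<partial>L) \<longlonglongrightarrow> emeasure L C"
    if L: "prob_space L" "sets L = sets borel" and C: "closed C" "C \<noteq> {}" for L and C :: "'a set"
  proof -
    interpret L: prob_space L by fact
    note L(2)[measurable_cong]
    have [measurable]: "C \<in> sets borel" using C by simp
    have [measurable]: "(\<lambda>x. infdist x C) \<in> borel_measurable borel"
      by (intro borel_measurable_continuous_onI continuous_intros)
    have "(\<lambda>n. \<integral>\<^sup>+x. ennreal (max 0 (1 - real n * infdist x C)) \<partial>L) \<longlonglongrightarrow> (\<integral>\<^sup>+x. indicator C x \<partial>L)"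
    proof (rule nn_integral_dominated_convergence[where w = "\<lambda>_. 1"])
      show "AE x in L. (\<lambda>n. ennreal (max 0 (1 - real n * infdist x C))) \<longlonglongrightarrow> indicator C x"
      proof (rule AE_I2)
        fix x
        show "(\<lambda>n. ennreal (max 0 (1 - real n * infdist x C))) \<longlonglongrightarrow> indicator C x"
        proof (cases "x \<in> C")
          case True then show ?thesis by simp
        next
          case False
          then have pos: "infdist x C > 0"
            using C by (metis in_closed_iff_infdist_zero infdist_nonneg less_eq_real_def)
          obtain n0 where n0: "real n0 * infdist x C > 1"
            using pos reals_Archimedean3 by blast
          have "\<forall>\<^sub>F n in sequentially. ennreal (max 0 (1 - real n * infdist x C)) = 0"
            using eventually_ge_at_top[of n0]
          proof eventually_elim
            case (elim n)
            have "real n0 * infdist x C \<le> real n * infdist x C"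
              using elim pos by (intro mult_right_mono) auto
            with n0 show ?case by simp
          qed
          with False show ?thesis by (simp add: tendsto_eventually)
        qed
      qed
      show "(\<integral>\<^sup>+ x. 1 \<partial>L) < \<infinity>" using L.emeasure_space_1 by simp
    qed (auto simp: infdist_nonneg ennreal_le_1)
    then show ?thesis by (simp add: L(2))
  qed
  \<comment> \<open>\<open>infdist x {}\<close> is 0 by convention, so for the empty set the
    approximating functions would be constantly 1; this case is treated apart.\<close>
  have closed: "emeasure M C = emeasure N C" if C: "closed C" for C
  proof (cases "C = {}")
    case False
    have "(\<integral>\<^sup>+x. ennreal (max 0 (1 - real n * infdist x C)) \<partial>M)
        = (\<integral>\<^sup>+x. ennreal (max 0 (1 - real n * infdist x C)) \<partial>N)" for n
      by (intro cont continuous_intros) (simp add: infdist_nonneg)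
    with lim[OF M C False] lim[OF N C False] show ?thesis
      by (simp add: LIMSEQ_unique)
  qed simp
  show "M = N"
  proof (rule measure_eqI_generator_eq[where E = "Collect closed" and \<Omega> = UNIV and A = "\<lambda>_. UNIV"])
    show "sets M = sigma_sets UNIV (Collect closed)" "sets N = sigma_sets UNIV (Collect closed)"
      using M N by (simp_all add: borel_eq_closed)
  qed (use M N prob_space.emeasure_space_1[OF M(1)] sets_eq_imp_space_eq[OF M(2)] in \<open>auto simp: Int_stable_def closed\<close>)
qed

text \<open>Independence turns the sum into a product of characteristic functions. The noise factor
  is an exponential, thus nonzero at every \<open>s\<close> and for every \<open>c\<close>, and
  cancels.\<close>

lemma gaussian_deconvolution:
  fixes X X' :: "'w \<Rightarrow> 'a::euclidean_space" and c :: real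
  assumes L: "prob_space L" "X \<in> borel_measurable L" and L': "prob_space L'" "X' \<in> borel_measurable L'"
    and eq: "distr (L \<Otimes>\<^sub>M std_gaussian) borel (\<lambda>(z, n). X z + c *\<^sub>R n)
           = distr (L' \<Otimes>\<^sub>M std_gaussian) borel (\<lambda>(z, n). X' z + c *\<^sub>R n)"
  shows "distr L borel X = distr L' borel X'"
proof (rule measure_eqI_char)
  have char: "(\<integral>x. iexp (s \<bullet> x) \<partial>distr (L \<Otimes>\<^sub>M std_gaussian) borel (\<lambda>(z, n). X z + c *\<^sub>R n))
      = (\<integral>x. iexp (s \<bullet> x) \<partial>distr L borel X) * complex_of_real (exp (- (norm (c *\<^sub>R s))\<^sup>2 / 2))"
    if L: "prob_space L" and [measurable]: "X \<in> borel_measurable L" for L and X :: "'w \<Rightarrow> 'a" and s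
  proof -
    interpret L: prob_space L by fact
    interpret G: prob_space "std_gaussian :: 'a measure" by (rule prob_space_std_gaussian)
    interpret P: pair_prob_space L "std_gaussian :: 'a measure" ..
    have int: "integrable (L \<Otimes>\<^sub>M std_gaussian) (\<lambda>(z, n). iexp (s \<bullet> (X z + c *\<^sub>R n)))"
      unfolding split_def by (rule P.integrable_iexp) auto
    have "(\<integral>x. iexp (s \<bullet> x) \<partial>distr (L \<Otimes>\<^sub>M std_gaussian) borel (\<lambda>(z, n). X z + c *\<^sub>R n))
        = (\<integral>(z, n). iexp (s \<bullet> (X z + c *\<^sub>R n)) \<partial>(L \<Otimes>\<^sub>M std_gaussian))"
      by (subst integral_distr) (auto simp: split_def)
    also have "\<dots> = (\<integral>z. (\<integral>n. iexp (s \<bullet> (X z + c *\<^sub>R n)) \<partial>std_gaussian) \<partial>L)"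
      by (rule P.integral_fst[OF int, symmetric])
    also have "\<dots> = (\<integral>z. (\<integral>n. iexp (s \<bullet> X z) * iexp ((c *\<^sub>R s) \<bullet> n) \<partial>std_gaussian) \<partial>L)"
      by (simp add: exp_add[symmetric] algebra_simps inner_add_right)
    also have "\<dots> = (\<integral>z. iexp (s \<bullet> X z) \<partial>L) * complex_of_real (exp (- (norm (c *\<^sub>R s))\<^sup>2 / 2))"
      by (simp only: integral_mult_right_zero integral_mult_left_zero char_std_gaussian)
    also have "(\<integral>z. iexp (s \<bullet> X z) \<partial>L) = (\<integral>x. iexp (s \<bullet> x) \<partial>distr L borel X)"
      by (subst integral_distr) auto
    finally show ?thesis .
  qed
  show "(\<integral>x. iexp (s \<bullet> x) \<partial>distr L borel X) = (\<integral>x. iexp (s \<bullet> x) \<partial>distr L' borel X')" for s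
    using char[OF L, of s] char[OF L', of s] eq by simp
qed (use L L' in \<open>auto intro: prob_space.prob_space_distr\<close>)

section \<open>Lebesgue measure on spaces of vectors\<close>

lemma prod_Basis_vec:
  fixes h :: "'a::euclidean_space^'t::finite \<Rightarrow> 'c::comm_monoid_mult"
  shows "(\<Prod>b\<in>Basis. h b) = (\<Prod>t\<in>UNIV. \<Prod>u\<in>Basis. h (axis t u))"
proof -
  have "(\<Prod>b\<in>Basis. h b) = (\<Prod>b\<in>(\<lambda>(t,u). axis t u) ` (UNIV \<times> Basis). h b)"
    by (rule prod.cong) (auto simp: Basis_vec_def)
  also have "\<dots> = (\<Prod>p\<in>UNIV \<times> Basis. h (case p of (t,u) \<Rightarrow> axis t u))"
    by (subst prod.reindex)
      (auto simp: inj_on_def axis_eq_axis nonzero_Basis)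
  also have "\<dots> = (\<Prod>t\<in>UNIV. \<Prod>u\<in>Basis. h (axis t u))"
    by (simp add: prod.cartesian_product split_def)
  finally show ?thesis .
qed

lemma box_vec: "box l u = {x :: 'a::euclidean_space^'t::finite. \<forall>t. x $ t \<in> box (l $ t) (u $ t)}"
  by (auto simp: mem_box Basis_vec_def inner_axis)

lemma measurable_vec_lambda:
  fixes g :: "'t::finite \<Rightarrow> 'w \<Rightarrow> 'a::euclidean_space"
  assumes "\<And>t. g t \<in> borel_measurable M"
  shows "(\<lambda>w. \<chi> t. g t w) \<in> borel_measurable M"
  unfolding borel_measurable_euclidean_space[where f = "\<lambda>w. \<chi> t. g t w"]
  using assms by (auto simp: Basis_vec_def inner_axis)

lemma measurable_vec_nth [measurable]: "(\<lambda>x :: 'a::euclidean_space^'t::finite. x $ t) \<in> borel_measurable borel"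
  by (intro borel_measurable_continuous_onI continuous_intros)

text \<open>Both measures give a box the product of its side lengths. Integrals over trajectories
  thereby become iterated integrals over columns, and integrals over one vector become iterated
  integrals over coordinates.\<close>

lemma lborel_vec:
  "(lborel :: ('a::euclidean_space^'t::finite) measure) =
     distr (\<Pi>\<^sub>M t\<in>UNIV. lborel) borel (\<lambda>w. \<chi> t. w t)"
proof (rule lborel_eqI)
  fix l u :: "'a^'t"
  assume le: "\<And>b. b \<in> Basis \<Longrightarrow> l \<bullet> b \<le> u \<bullet> b"
  interpret product_sigma_finite "\<lambda>_::'t. lborel :: 'a measure" ..
  have m: "(\<lambda>w :: 't \<Rightarrow> 'a. \<chi> t. w t) \<in> borel_measurable (\<Pi>\<^sub>M t\<in>UNIV. lborel)"
    by (intro measurable_vec_lambda) simp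
  have le': "l $ t \<bullet> b \<le> u $ t \<bullet> b" if "b \<in> Basis" for t b
    using le[of "axis t b"] that by (simp add: inner_axis)
  have "(\<lambda>w. \<chi> t. w t) -` box l u \<inter> space (\<Pi>\<^sub>M t\<in>(UNIV::'t set). lborel :: 'a measure)
      = (\<Pi>\<^sub>E t\<in>UNIV. box (l $ t) (u $ t))"
    by (auto simp: box_vec space_PiM)
  then have "emeasure (distr (\<Pi>\<^sub>M t\<in>UNIV. lborel) borel (\<lambda>w. \<chi> t. w t)) (box l u)
      = (\<Prod>t\<in>UNIV. emeasure lborel (box (l $ t) (u $ t)))"
    using m by (simp add: emeasure_distr emeasure_PiM)
  also have "\<dots> = (\<Prod>t\<in>UNIV. ennreal (\<Prod>b\<in>Basis. (u $ t - l $ t) \<bullet> b))"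
    using le' by (simp add: emeasure_lborel_box)
  also have "\<dots> = ennreal (\<Prod>b\<in>Basis. (u - l) \<bullet> b)"
    by (subst prod_Basis_vec, subst prod_ennreal)
      (auto simp: inner_axis inner_diff_left le' intro!: prod_nonneg)
  finally show "emeasure (distr (\<Pi>\<^sub>M t\<in>UNIV. lborel) borel (\<lambda>w. \<chi> t. w t)) (box l u)
      = ennreal (\<Prod>b\<in>Basis. (u - l) \<bullet> b)" .
qed simp

lemma nn_integral_vec_prod:
  fixes f :: "'t::finite \<Rightarrow> 'a::euclidean_space \<Rightarrow> ennreal"
  assumes [measurable]: "\<And>t. f t \<in> borel_measurable borel"
  shows "(\<integral>\<^sup>+ x. (\<Prod>t\<in>UNIV. f t (x $ t)) \<partial>lborel) = (\<Prod>t\<in>UNIV. \<integral>\<^sup>+ y. f t y \<partial>lborel)"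
proof -
  interpret product_sigma_finite "\<lambda>_::'t. lborel :: 'a measure" ..
  have m: "(\<lambda>w :: 't \<Rightarrow> 'a. \<chi> t. w t) \<in> borel_measurable (\<Pi>\<^sub>M t\<in>UNIV. lborel)"
    by (intro measurable_vec_lambda) simp
  show ?thesis
    by (subst lborel_vec, subst nn_integral_distr[OF m])
       (auto simp: product_nn_integral_prod)
qed

text \<open>A nonempty open set is not negligible. Every passage below from almost all points to all
  points rests on this.\<close>

lemma open_empty_if_AE_not_in:
  fixes U :: "'a::euclidean_space set"
  assumes "open U" "AE x in lebesgue. x \<notin> U"
  shows "U = {}"
proof -
  have "U \<in> sets lebesgue" using assms(1) by (simp add: borel_open sets_completionI_sets)
  then have "U \<in> null_sets lebesgue" using assms(2) by (simp add: AE_iff_null_sets)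
  then show ?thesis using open_not_negligible[OF assms(1)] by (auto simp: negligible_iff_null_sets)
qed

lemma continuous_AE_eq:
  fixes f g :: "'a::euclidean_space \<Rightarrow> real"
  assumes "continuous_on UNIV f" "continuous_on UNIV g" "AE x in lborel. f x = g x"
  shows "f x = g x"
proof -
  have "open {x. f x \<noteq> g x}" by (intro open_Collect_neq assms)
  moreover have "AE x in lebesgue. x \<notin> {x. f x \<noteq> g x}"
    using AE_completion[OF assms(3)] by simp
  ultimately have "{x. f x \<noteq> g x} = {}" by (rule open_empty_if_AE_not_in)
  then show ?thesis by blast
qed

section \<open>Change of variables\<close>

text \<open>The change-of-variables theorem of the library needs a well-ordered index type.\<close>

typedef (overloaded) ('b::finite) ordered_index = "{..<CARD('b)}"
  by (rule exI[of _ 0]) simp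

instantiation ordered_index :: (finite) linorder
begin
definition "less_eq_ordered_index (i :: 'a ordered_index) (j :: 'a ordered_index) \<longleftrightarrow> Rep_ordered_index i \<le> Rep_ordered_index j"
definition "less_ordered_index (i :: 'a ordered_index) (j :: 'a ordered_index) \<longleftrightarrow> Rep_ordered_index i < Rep_ordered_index j"
instance
  by standard (auto simp: less_eq_ordered_index_def less_ordered_index_def Rep_ordered_index_inject)
end

instance ordered_index :: (finite) wellorder
proof
  fix P :: "'a ordered_index \<Rightarrow> bool" and a
  assume P: "\<And>x. (\<And>y. y < x \<Longrightarrow> P y) \<Longrightarrow> P x"
  show "P a"
  proof (induction a rule: measure_induct_rule[of Rep_ordered_index])
    case (less x)
    show ?case by (rule P, rule less) (simp add: less_ordered_index_def)
  qed
qed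

instance ordered_index :: (finite) finite
proof
  show "finite (UNIV :: 'a ordered_index set)"
    using type_definition.Abs_image[OF type_definition_ordered_index[where 'b='a]]
    by (metis finite_imageI finite_lessThan)
qed

lemma ex_bij_ordered_index: "\<exists>e :: 'b::finite ordered_index \<Rightarrow> 'b. bij e"
proof -
  obtain h where h: "bij_betw h {0..<CARD('b)} (UNIV :: 'b set)"
    using ex_bij_betw_nat_finite[of "UNIV :: 'b set"] by auto
  have "bij_betw (Rep_ordered_index :: 'b ordered_index \<Rightarrow> nat) UNIV {0..<CARD('b)}"
    unfolding bij_betw_def
    using type_definition.Rep_range[OF type_definition_ordered_index[where 'b='b]]
    by (auto simp: inj_def Rep_ordered_index_inject)
  then show ?thesis using bij_betw_trans[OF _ h] by blast
qed

text \<open>Conjugation with \<open>e\<close> matches the permutations of the two index types and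
  keeps their signs, so the Leibniz sums agree term by term.\<close>

lemma det_reindex:
  fixes M :: "real^'n::finite^'n" and e :: "'m::finite \<Rightarrow> 'n"
  assumes e: "bij e"
  shows "det (\<chi> i j. M $ e i $ e j) = det M"
proof -
  let ?g = "map_permutation UNIV e"
  have g: "?g p = e \<circ> p \<circ> inv e" for p :: "'m \<Rightarrow> 'm"
    using e by (auto simp: map_permutation_def restrict_id_def fun_eq_iff bij_def)
  have ig: "inv e (e i) = i" "e (inv e k) = k" for i k
    using e by (auto simp: bij_def surj_f_inv_f)
  have bg: "bij_betw ?g {p. p permutes UNIV} {p. p permutes UNIV}"
  proof (rule bij_betw_byWitness[where f' = "\<lambda>q. inv e \<circ> q \<circ> e"])
    show "?g ` {p. p permutes UNIV} \<subseteq> {p. p permutes UNIV}"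
      using e map_permutation_permutes by blast
    show "(\<lambda>q. inv e \<circ> q \<circ> e) ` {p. p permutes UNIV} \<subseteq> {p. p permutes UNIV}"
    proof clarify
      fix q :: "'n \<Rightarrow> 'n" assume "q permutes UNIV"
      then have "bij q" by (simp add: permutes_bij)
      then have "bij (inv e \<circ> q \<circ> e)" using e by (simp add: bij_comp bij_imp_bij_inv)
      then show "(inv e \<circ> q \<circ> e) permutes UNIV"
        unfolding permutes_def bij_iff by blast
    qed
  qed (auto simp: g ig fun_eq_iff)
  have "det M = (\<Sum>q | q permutes UNIV. of_int (sign q) * (\<Prod>k\<in>UNIV. M $ k $ q k))"
    by (simp add: det_def)
  also have "\<dots> = (\<Sum>p | p permutes (UNIV::'m set). of_int (sign (?g p)) * (\<Prod>k\<in>UNIV. M $ k $ ?g p k))"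
    by (rule sum.reindex_bij_betw[OF bg, symmetric])
  also have "\<dots> = (\<Sum>p | p permutes (UNIV::'m set). of_int (sign p) * (\<Prod>i\<in>UNIV. M $ e i $ e (p i)))"
  proof (rule sum.cong[OF refl])
    fix p :: "'m \<Rightarrow> 'm" assume p: "p \<in> {p. p permutes UNIV}"
    have "sign (?g p) = sign p"
      using p e by (intro sign_map_permutation) (auto simp: bij_def)
    moreover have "(\<Prod>k\<in>UNIV. M $ k $ ?g p k) = (\<Prod>i\<in>UNIV. M $ e i $ ?g p (e i))"
      using e by (intro prod.reindex_bij_betw[symmetric])
    ultimately show "of_int (sign (?g p)) * (\<Prod>k\<in>UNIV. M $ k $ ?g p k)
        = of_int (sign p) * (\<Prod>i\<in>UNIV. M $ e i $ e (p i))"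
      by (simp add: g ig)
  qed
  also have "\<dots> = det (\<chi> i j. M $ e i $ e j)"
    by (simp add: det_def)
  finally show ?thesis by simp
qed

section \<open>Jacobian formula for differentiable bijections\<close>

lemma borel_measurable_if_has_derivative:
  fixes f :: "'a::euclidean_space \<Rightarrow> 'b::euclidean_space"
  assumes "\<And>x. (f has_derivative f' x) (at x)"
  shows "f \<in> borel_measurable borel"
  using assms by (intro borel_measurable_continuous_onI has_derivative_continuous_on)

text \<open>As an identity of measures, the formula has to be tested on boxes only, and it then
  applies to every nonnegative Borel integrand.\<close>

lemma lborel_change_of_variables_wellorder:
  fixes v :: "real^'n::{finite,wellorder} \<Rightarrow> real^'n::_"
  assumes v: "bij v" and d: "\<And>x. (v has_derivative v' x) (at x)"
    and J: "\<And>x. J x = \<bar>det (matrix (v' x))\<bar>" and m[measurable]: "J \<in> borel_measurable borel"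
  shows "lborel = distr (density lborel (\<lambda>x. ennreal (J x))) borel v"
proof (rule lborel_eqI)
  have mv[measurable]: "v \<in> borel_measurable borel"
    using d by (rule borel_measurable_if_has_derivative)
  fix l u :: "real^'n::_" assume le: "\<And>b. b \<in> Basis \<Longrightarrow> l \<bullet> b \<le> u \<bullet> b"
  let ?S = "v -` box l u"
  have S[measurable]: "?S \<in> sets borel"
    using measurable_sets_borel[OF mv, of "box l u"] by simp
  have img: "v ` ?S = box l u" using v by (simp add: bij_def surj_image_vimage_eq)
  let ?c = "\<Prod>b\<in>Basis. (u - l) \<bullet> b"
  have "?S \<in> sets lebesgue" "inj_on v ?S"
    using v by (auto simp: bij_def inj_on_def)
  \<comment> \<open>The fact used is an equivalence between the image having measure
    \<open>?c\<close> and the Jacobian having integral \<open>?c\<close>. It is read from the known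
    volume of the box towards the integral over its preimage.\<close>
  from has_measure_differentiable_image[OF this(1) has_derivative_at_withinI[OF d] this(2), of ?c]
  have "((\<lambda>x. \<bar>det (matrix (v' x))\<bar>) has_integral ?c) ?S"
    unfolding img using le by simp
  then have "(J has_integral ?c) ?S"
    unfolding J[abs_def] .
  with _ have "(\<integral>\<^sup>+ x. ennreal (J x) * indicator ?S x \<partial>lborel) = (\<Prod>b\<in>Basis. (u - l) \<bullet> b)"
    by (rule nn_integral_has_integral_lebesgue') (simp add: J)
  then show "emeasure (distr (density lborel (\<lambda>x. ennreal (J x))) borel v) (box l u)
      = (\<Prod>b\<in>Basis. (u - l) \<bullet> b)"
    by (simp add: emeasure_distr emeasure_density)
qed simp

lemma lborel_reindex:
  fixes e :: "'m::finite \<Rightarrow> 'n::finite"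
  assumes e: "bij e"
  shows "(lborel :: (real^'m) measure) = distr (lborel :: (real^'n) measure) borel (\<lambda>x. \<chi> i. x $ e i)"
proof (rule lborel_eqI)
  have ig: "inv e (e i) = i" "e (inv e k) = k" for i k
    using e by (auto simp: bij_def surj_f_inv_f)
  fix l u :: "real^'m" assume le: "\<And>b. b \<in> Basis \<Longrightarrow> l \<bullet> b \<le> u \<bullet> b"
  have le': "l $ i \<le> u $ i" for i using le[of "axis i 1"] by (simp add: inner_axis)
  define l' u' :: "real^'n" where "l' = (\<chi> k. l $ inv e k)" and "u' = (\<chi> k. u $ inv e k)"
  have "(\<lambda>x::real^'n. (\<chi> i. x $ e i)) -` box l u = box l' u'"
    unfolding l'_def u'_def
    by (auto simp: box_vec) (metis ig)+
  then have "emeasure (distr (lborel :: (real^'n) measure) borel (\<lambda>x. \<chi> i. x $ e i)) (box l u)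
      = emeasure lborel (box l' u')"
    by (subst emeasure_distr) (auto intro!: measurable_vec_lambda)
  also have "\<dots> = (\<Prod>k\<in>UNIV. u $ inv e k - l $ inv e k)"
  proof (subst emeasure_lborel_box)
    show "l' \<bullet> b \<le> u' \<bullet> b" if "b \<in> Basis" for b
      using that by (auto simp: Basis_vec_def inner_axis l'_def u'_def le')
  qed (simp add: prod_Basis_vec inner_axis inner_diff_left l'_def u'_def)
  also have "(\<Prod>k\<in>UNIV. u $ inv e k - l $ inv e k) = (\<Prod>i\<in>UNIV. u $ i - l $ i)"
    using e by (intro prod.reindex_bij_betw) (rule bij_imp_bij_inv)
  also have "\<dots> = (\<Prod>b\<in>Basis. (u - l) \<bullet> b)"
    by (simp add: prod_Basis_vec inner_axis inner_diff_left)
  finally show "emeasure (distr (lborel :: (real^'n) measure) borel (\<lambda>x. \<chi> i. x $ e i)) (box l u)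
      = (\<Prod>b\<in>Basis. (u - l) \<bullet> b)" .
qed simp

text \<open>A renumbering of the coordinates turns \<open>v\<close> into \<open>w\<close> on a
  well-ordered index type. It preserves \<open>lborel\<close> and relabels rows and columns of the
  Jacobian matrix alike, which keeps the determinant.\<close>

lemma nn_integral_change_of_variables:
  fixes v :: "real^'n::finite \<Rightarrow> real^'n"
  assumes v: "bij v" and d: "\<And>x. (v has_derivative v' x) (at x)"
    and J: "\<And>x. J x = \<bar>det (matrix (v' x))\<bar>" and m[measurable]: "J \<in> borel_measurable borel"
    and f[measurable]: "f \<in> borel_measurable borel"
  shows "(\<integral>\<^sup>+ x. ennreal (J x) * f (v x) \<partial>lborel) = (\<integral>\<^sup>+ x. f x \<partial>lborel)"
proof -
  obtain e :: "'n ordered_index \<Rightarrow> 'n" where e: "bij e" using ex_bij_ordered_index by blast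
  have ig: "inv e (e i) = i" "e (inv e k) = k" for i k
    using e by (auto simp: bij_def surj_f_inv_f)
  define \<Phi> :: "real^'n \<Rightarrow> real^('n ordered_index)" where "\<Phi> x = (\<chi> i. x $ e i)" for x
  define \<Psi> :: "real^('n ordered_index) \<Rightarrow> real^'n" where "\<Psi> y = (\<chi> k. y $ inv e k)" for y
  have inv: "\<Phi> (\<Psi> y) = y" "\<Psi> (\<Phi> x) = x" for x y
    by (auto simp: \<Phi>_def \<Psi>_def vec_eq_iff ig)
  have lin: "linear \<Phi>" "linear \<Psi>"
    by (auto simp: \<Phi>_def \<Psi>_def linear_iff vec_eq_iff)
  have [measurable]: "\<Phi> \<in> borel_measurable borel" "\<Psi> \<in> borel_measurable borel"
    unfolding \<Phi>_def \<Psi>_def by (auto intro!: measurable_vec_lambda)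
  have mv[measurable]: "v \<in> borel_measurable borel"
    using d by (rule borel_measurable_if_has_derivative)
  define w where "w = \<Phi> \<circ> v \<circ> \<Psi>"
  define w' where "w' y = \<Phi> \<circ> v' (\<Psi> y) \<circ> \<Psi>" for y
  have "bij \<Phi>" "bij \<Psi>" by (metis inv bijI')+
  then have bw: "bij w" unfolding w_def using v by (intro bij_comp)
  have dw: "(w has_derivative w' y) (at y)" for y
    unfolding w_def w'_def o_assoc[symmetric]
    by (intro diff_chain_at linear_imp_has_derivative[OF lin(1)] linear_imp_has_derivative[OF lin(2)] d)

  have det: "det (matrix (w' y)) = det (matrix (v' (\<Psi> y)))" for y
  proof -
    have "\<Psi> (axis j 1) = axis (e j) 1" for j
      by (auto simp: \<Psi>_def vec_eq_iff axis_def ig)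
    moreover have "\<Phi> z $ i = z $ e i" for z i by (simp add: \<Phi>_def)
    ultimately have "matrix (w' y) = (\<chi> i j. matrix (v' (\<Psi> y)) $ e i $ e j)"
      by (intro vec_eq_iff[THEN iffD2] allI) (simp add: matrix_def w'_def)
    then show ?thesis using det_reindex[OF e] by simp
  qed
  have lb': "(lborel :: (real^'n) measure) = distr lborel borel \<Psi>"
    unfolding \<Psi>_def by (rule lborel_reindex[OF bij_imp_bij_inv[OF e]])
  have Jw: "J (\<Psi> y) = \<bar>det (matrix (w' y))\<bar>" for y by (simp add: det J)
  have mw: "(\<lambda>y. J (\<Psi> y)) \<in> borel_measurable borel" by measurable
  have "(\<integral>\<^sup>+ x. f x \<partial>lborel) = (\<integral>\<^sup>+ y. f (\<Psi> y) \<partial>lborel)"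
    by (subst lb') (simp add: nn_integral_distr)
  also have "\<dots> = (\<integral>\<^sup>+ y. ennreal (J (\<Psi> y)) * f (\<Psi> (w y)) \<partial>lborel)"
  proof -
    have [measurable]: "w \<in> borel_measurable borel" unfolding w_def by measurable
    show ?thesis
      by (subst lborel_change_of_variables_wellorder[OF bw dw Jw mw])
         (simp add: nn_integral_distr nn_integral_density)
  qed
  also have "\<dots> = (\<integral>\<^sup>+ y. ennreal (J (\<Psi> y)) * f (v (\<Psi> y)) \<partial>lborel)"
    by (simp add: w_def inv)
  also have "\<dots> = (\<integral>\<^sup>+ x. ennreal (J x) * f (v x) \<partial>lborel)"
    by (subst lb') (simp add: nn_integral_distr)
  finally show ?thesis by simp
qed

text \<open>The map on trajectories acts on each column separately. On a box the integrand is a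
  product over columns, so the formula for one column is applied factor by factor, and the
  determinant of the large block-diagonal Jacobian never appears.\<close>

lemma nn_integral_change_of_variables_columns:
  fixes v :: "real^'n::finite \<Rightarrow> real^'n" and h :: "real^'n^'t::finite \<Rightarrow> ennreal"
  assumes v: "bij v" and d: "\<And>x. (v has_derivative v' x) (at x)"
    and J: "\<And>x. J x = \<bar>det (matrix (v' x))\<bar>" and m[measurable]: "J \<in> borel_measurable borel"
    and h[measurable]: "h \<in> borel_measurable borel"
  shows "(\<integral>\<^sup>+ zs. (\<Prod>t\<in>UNIV. ennreal (J (zs $ t))) * h (\<chi> t. v (zs $ t)) \<partial>lborel)
    = (\<integral>\<^sup>+ zs. h zs \<partial>lborel)"
proof -
  have mv[measurable]: "v \<in> borel_measurable borel"
    using d by (rule borel_measurable_if_has_derivative)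
  let ?V = "\<lambda>zs :: real^'n^'t. \<chi> t. v (zs $ t)"
  have mV[measurable]: "?V \<in> borel_measurable borel"
    by (intro measurable_vec_lambda) measurable
  let ?D = "density lborel (\<lambda>zs :: real^'n^'t. \<Prod>t\<in>UNIV. ennreal (J (zs $ t)))"
  have "lborel = distr ?D borel ?V"
  proof (rule lborel_eqI)
    fix l u :: "real^'n^'t" assume le: "\<And>b. b \<in> Basis \<Longrightarrow> l \<bullet> b \<le> u \<bullet> b"
    have "emeasure (distr ?D borel ?V) (box l u)
      = (\<integral>\<^sup>+ zs. (\<Prod>t\<in>UNIV. ennreal (J (zs $ t))) * indicator (?V -` box l u) zs \<partial>lborel)"
      using measurable_sets_borel[OF mV, of "box l u"]
      by (subst emeasure_distr) (auto simp: emeasure_density)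
    also have "\<dots> = (\<integral>\<^sup>+ zs. (\<Prod>t\<in>UNIV. ennreal (J (zs $ t)) * indicator (box (l $ t) (u $ t)) (v (zs $ t))) \<partial>lborel)"
    proof (rule nn_integral_cong)
      fix zs :: "real^'n^'t"
      have "indicator (?V -` box l u) zs = (\<Prod>t\<in>UNIV. indicator (box (l $ t) (u $ t)) (v (zs $ t)) :: ennreal)"
      proof (cases "\<forall>t. v (zs $ t) \<in> box (l $ t) (u $ t)")
        case True then show ?thesis by (simp add: box_vec)
      next
        case False
        then obtain t where "v (zs $ t) \<notin> box (l $ t) (u $ t)" by blast
        then have "(\<Prod>t\<in>UNIV. indicator (box (l $ t) (u $ t)) (v (zs $ t)) :: ennreal) = 0"
          by (intro prod_zero) (auto intro: exI[of _ t])
        with False show ?thesis by (simp add: box_vec)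
      qed
      then show "(\<Prod>t\<in>UNIV. ennreal (J (zs $ t))) * indicator (?V -` box l u) zs
        = (\<Prod>t\<in>UNIV. ennreal (J (zs $ t)) * indicator (box (l $ t) (u $ t)) (v (zs $ t)))"
        by (simp add: prod.distrib)
    qed
    also have "\<dots> = (\<Prod>t\<in>UNIV. \<integral>\<^sup>+ x. ennreal (J x) * indicator (box (l $ t) (u $ t)) (v x) \<partial>lborel)"
      by (rule nn_integral_vec_prod) measurable
    also have "\<dots> = (\<Prod>t\<in>UNIV. \<integral>\<^sup>+ x. indicator (box (l $ t) (u $ t)) x \<partial>lborel)"
      by (subst nn_integral_change_of_variables[OF v d J m]) auto
    also have "\<dots> = (\<integral>\<^sup>+ zs. (\<Prod>t\<in>UNIV. indicator (box (l $ t) (u $ t)) (zs $ t)) \<partial>lborel)"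
      by (rule nn_integral_vec_prod[symmetric]) measurable
    also have "\<dots> = (\<integral>\<^sup>+ zs. indicator (box l u) zs \<partial>lborel)"
    proof (rule nn_integral_cong)
      fix zs :: "real^'n^'t"
      show "(\<Prod>t\<in>UNIV. indicator (box (l $ t) (u $ t)) (zs $ t)) = (indicator (box l u) zs :: ennreal)"
      proof (cases "\<forall>t. zs $ t \<in> box (l $ t) (u $ t)")
        case True then show ?thesis by (simp add: box_vec)
      next
        case False
        then obtain t where "zs $ t \<notin> box (l $ t) (u $ t)" by blast
        then have "(\<Prod>t\<in>UNIV. indicator (box (l $ t) (u $ t)) (zs $ t) :: ennreal) = 0"
          by (intro prod_zero) (auto intro: exI[of _ t])
        with False show ?thesis by (simp add: box_vec)
      qed
    qed
    finally show "emeasure (distr ?D borel ?V) (box l u) = (\<Prod>b\<in>Basis. (u - l) \<bullet> b)"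
      using le by (simp add: emeasure_lborel_box)
  qed simp
  then have "(\<integral>\<^sup>+ zs. h zs \<partial>lborel) = (\<integral>\<^sup>+ zs. h zs \<partial>distr ?D borel ?V)" by simp
  also have "\<dots> = (\<integral>\<^sup>+ zs. (\<Prod>t\<in>UNIV. ennreal (J (zs $ t))) * h (?V zs) \<partial>lborel)"
    by (simp add: nn_integral_distr nn_integral_density)
  finally show ?thesis by simp
qed

section \<open>Calculus of functions of class C-k\<close>

lemma frechet_derivative_cong_open:
  assumes "open U" "x \<in> U" "\<And>y. y \<in> U \<Longrightarrow> f y = g y"
  shows "frechet_derivative f (at x) = frechet_derivative g (at x)"
proof -
  have "(f has_derivative D) (at x) \<longleftrightarrow> (g has_derivative D) (at x)" for D
    by (intro iffI; erule has_derivative_transform_within_open[OF _ assms(1,2)]) (simp_all add: assms(3))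
  then show ?thesis by (simp add: frechet_derivative_def)
qed

lemma Ck_open_cong:
  assumes U: "open U" and eq: "\<And>y. y \<in> U \<Longrightarrow> f y = g y"
  shows "Ck_open k U f \<longleftrightarrow> Ck_open k U g"
  using eq
proof (induction k arbitrary: f g)
  case 0
  then show ?case by (simp cong: continuous_on_cong)
next
  case (Suc k)
  have "f differentiable (at x) \<longleftrightarrow> g differentiable (at x)" if "x \<in> U" for x
    using U that Suc.prems unfolding differentiable_def
    by (metis has_derivative_transform_within_open)
  moreover have "Ck_open k U (\<lambda>x. frechet_derivative f (at x) b)
      \<longleftrightarrow> Ck_open k U (\<lambda>x. frechet_derivative g (at x) b)" for b
    using frechet_derivative_cong_open[OF U _ Suc.prems] by (intro Suc.IH) simp
  ultimately show ?case by simp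
qed

lemma Ck_open_subset: "Ck_open k U f \<Longrightarrow> V \<subseteq> U \<Longrightarrow> Ck_open k V f"
  by (induction k arbitrary: f) (auto intro: continuous_on_subset)

lemma Ck_open_imp_continuous_on: "Ck_open k U f \<Longrightarrow> continuous_on U f"
  by (cases k) (auto intro!: continuous_at_imp_continuous_on differentiable_imp_continuous_within)

lemma Ck_open_Suc_has_derivative:
  "Ck_open (Suc k) U f \<Longrightarrow> x \<in> U \<Longrightarrow> (f has_derivative frechet_derivative f (at x)) (at x)"
  by (simp add: frechet_derivative_works)

section \<open>Class C-1 and the chain rule\<close>

lemma has_derivative_Basis_sum:
  assumes "(f has_derivative D) F"
  shows "D w = (\<Sum>b\<in>Basis. (w \<bullet> b) *\<^sub>R D b)"
proof -
  interpret D: bounded_linear D using assms by (rule has_derivative_bounded_linear)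
  have "D w = D (\<Sum>b\<in>Basis. (w \<bullet> b) *\<^sub>R b)" by (simp add: euclidean_representation)
  then show ?thesis by (simp only: D.sum D.scaleR)
qed

lemma Ck_open_1_compose_has_derivative:
  assumes "Ck_open 1 U F" "(g has_derivative g') (at x)" "g x \<in> U"
  shows "((\<lambda>x. F (g x)) has_derivative (\<lambda>w. frechet_derivative F (at (g x)) (g' w))) (at x)"
  using diff_chain_at[OF assms(2) Ck_open_Suc_has_derivative[of 0 U F "g x"]] assms(1,3)
  by (simp add: o_def)

lemma Ck_open_1I:
  assumes U: "open U" and d: "\<And>x. x \<in> U \<Longrightarrow> (f has_derivative f' x) (at x)"
    and c: "\<And>b. b \<in> Basis \<Longrightarrow> continuous_on U (\<lambda>x. f' x b)"
  shows "Ck_open 1 U f"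
proof -
  have e: "frechet_derivative f (at x) = f' x" if "x \<in> U" for x
    using frechet_derivative_at[OF d[OF that]] by simp
  then have "continuous_on U (\<lambda>x. frechet_derivative f (at x) b)" if "b \<in> Basis" for b
    using c[OF that] by (simp cong: continuous_on_cong)
  then show ?thesis using d by (auto simp: differentiable_def)
qed

lemma Ck_open_1_compose:
  fixes g :: "'a::euclidean_space \<Rightarrow> 'b::euclidean_space" and F :: "'b \<Rightarrow> 'c::real_normed_vector"
  assumes F: "Ck_open 1 U F" and g: "Ck_open 1 V g" and V: "open V" and sub: "g ` V \<subseteq> U"
  shows "Ck_open 1 V (\<lambda>x. F (g x))"
proof (rule Ck_open_1I[OF V])
  let ?g' = "\<lambda>x. frechet_derivative g (at x)" and ?F' = "\<lambda>y. frechet_derivative F (at y)"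
  fix x assume "x \<in> V"
  then show "((\<lambda>x. F (g x)) has_derivative (\<lambda>w. ?F' (g x) (?g' x w))) (at x)"
    using g sub by (intro Ck_open_1_compose_has_derivative[OF F] Ck_open_Suc_has_derivative[of 0 V]) auto
next
  let ?g' = "\<lambda>x. frechet_derivative g (at x)" and ?F' = "\<lambda>y. frechet_derivative F (at y)"
  fix b :: 'a assume b: "b \<in> Basis"
  have "continuous_on V g" using g by (rule Ck_open_imp_continuous_on)
  then have "continuous_on V (\<lambda>x. ?F' (g x) c)" if "c \<in> Basis" for c
    using F that sub by (auto intro: continuous_on_compose2)
  moreover have "continuous_on V (\<lambda>x. ?g' x b)" using g b by auto
  ultimately have "continuous_on V (\<lambda>x. \<Sum>c\<in>Basis. (?g' x b \<bullet> c) *\<^sub>R ?F' (g x) c)"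
    by (auto intro!: continuous_intros)
  \<comment> \<open>\<open>Ck_open\<close> controls partial derivatives along \<open>Basis\<close>
    only, whereas the direction \<open>?g' x b\<close> varies with \<open>x\<close>; linearity
    expands it in basis directions.\<close>
  moreover have "?F' (g x) (?g' x b) = (\<Sum>c\<in>Basis. (?g' x b \<bullet> c) *\<^sub>R ?F' (g x) c)" if "x \<in> V" for x
  proof (rule has_derivative_Basis_sum)
    show "(F has_derivative ?F' (g x)) (at (g x))"
      using F sub that by (intro Ck_open_Suc_has_derivative[of 0 U]) auto
  qed
  ultimately show "continuous_on V (\<lambda>x. ?F' (g x) (?g' x b))"
    by (simp cong: continuous_on_cong)
qed

lemma Ck_open_1_linear: "linear L \<Longrightarrow> Ck_open 1 UNIV (L :: 'a::euclidean_space \<Rightarrow> 'b::euclidean_space)"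
  by (rule Ck_open_1I[where f' = "\<lambda>_. L"]) (auto intro: linear_imp_has_derivative)

lemma Ck_on_UNIV_iff: "Ck_on k UNIV f \<longleftrightarrow> Ck_open k UNIV f"
proof
  assume "Ck_on k UNIV f"
  then obtain F U where "UNIV \<subseteq> U" "Ck_open k U F" "\<forall>x. F x = f x"
    by (auto simp: Ck_on_def Ck_extension_def)
  moreover have "F = f" using calculation by auto
  moreover have "U = UNIV" using calculation by auto
  ultimately show "Ck_open k UNIV f" by simp
qed (auto simp: Ck_on_def Ck_extension_def)

lemma Ck_on_imp_continuous_on: "Ck_on k S f \<Longrightarrow> continuous_on S f"
  unfolding Ck_on_def Ck_extension_def
  by (metis Ck_open_imp_continuous_on continuous_on_cong continuous_on_subset)

section \<open>Class C-2: linear substitution, logarithm, sum\<close>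

lemma Ck_open_2I:
  assumes U: "open U" and d: "\<And>x. x \<in> U \<Longrightarrow> (f has_derivative f' x) (at x)"
    and d2: "\<And>b x. b \<in> Basis \<Longrightarrow> x \<in> U \<Longrightarrow> ((\<lambda>x. f' x b) has_derivative f'' b x) (at x)"
    and c: "\<And>b c. b \<in> Basis \<Longrightarrow> c \<in> Basis \<Longrightarrow> continuous_on U (\<lambda>x. f'' b x c)"
  shows "Ck_open 2 U f"
proof -
  have e: "frechet_derivative f (at x) = f' x" if "x \<in> U" for x
    using frechet_derivative_at[OF d[OF that]] by simp
  have "Ck_open 1 U (\<lambda>x. frechet_derivative f (at x) b)" if b: "b \<in> Basis" for b
  proof -
    have "Ck_open 1 U (\<lambda>x. f' x b)"
      using d2 c b by (intro Ck_open_1I[where f' = "f'' b"] U) auto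
    then show ?thesis
      using Ck_open_cong[OF U, of "\<lambda>x. frechet_derivative f (at x) b" "\<lambda>x. f' x b"] e by simp
  qed
  then show ?thesis
    unfolding numeral_2_eq_2 Ck_open.simps(2)[of "Suc 0"]
    using d by (auto simp: differentiable_def simp del: Ck_open.simps)
qed

lemma Ck_open_2E:
  assumes "Ck_open 2 U f"
  shows "x \<in> U \<Longrightarrow> (f has_derivative frechet_derivative f (at x)) (at x)"
    and "x \<in> U \<Longrightarrow> b \<in> Basis \<Longrightarrow> ((\<lambda>y. frechet_derivative f (at y) b) has_derivative
      frechet_derivative (\<lambda>y. frechet_derivative f (at y) b) (at x)) (at x)"
    and "b \<in> Basis \<Longrightarrow> c \<in> Basis \<Longrightarrow>
      continuous_on U (\<lambda>x. frechet_derivative (\<lambda>y. frechet_derivative f (at y) b) (at x) c)"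
    and "b \<in> Basis \<Longrightarrow> continuous_on U (\<lambda>x. frechet_derivative f (at x) b)"
proof -
  have f: "Ck_open (Suc (Suc 0)) U f" using assms by (simp add: numeral_2_eq_2)
  show "x \<in> U \<Longrightarrow> (f has_derivative frechet_derivative f (at x)) (at x)"
    using f by (rule Ck_open_Suc_has_derivative)
  have b: "Ck_open (Suc 0) U (\<lambda>x. frechet_derivative f (at x) b)" if "b \<in> Basis" for b
    using f that by auto
  show "x \<in> U \<Longrightarrow> b \<in> Basis \<Longrightarrow> ((\<lambda>y. frechet_derivative f (at y) b) has_derivative
      frechet_derivative (\<lambda>y. frechet_derivative f (at y) b) (at x)) (at x)"
    using b by (rule Ck_open_Suc_has_derivative)
  show "b \<in> Basis \<Longrightarrow> c \<in> Basis \<Longrightarrow>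
      continuous_on U (\<lambda>x. frechet_derivative (\<lambda>y. frechet_derivative f (at y) b) (at x) c)"
    using b by auto
  show "b \<in> Basis \<Longrightarrow> continuous_on U (\<lambda>x. frechet_derivative f (at x) b)"
    using b by (rule Ck_open_imp_continuous_on)
qed

text \<open>Meant for the linear maps from \<open>(z, zs, as)\<close> to
  \<open>(z $ i, zs, as)\<close>, which carry the regularity of one factor, whose first argument is
  real, over to the whole latent vector.\<close>

lemma Ck_open_2_linear_compose:
  fixes F :: "'b::euclidean_space \<Rightarrow> real" and L :: "'a::euclidean_space \<Rightarrow> 'b"
  assumes F: "Ck_open 2 U F" and U: "open U" and L: "linear L"
  shows "Ck_open 2 (L -` U) (\<lambda>x. F (L x))"
proof -
  note F1 = Ck_open_2E(1)[OF F] and F2 = Ck_open_2E(2)[OF F] and F3 = Ck_open_2E(3)[OF F]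
  let ?F1 = "\<lambda>y. frechet_derivative F (at y)"
  let ?F2 = "\<lambda>c y. frechet_derivative (\<lambda>y. ?F1 y c) (at y)"
  have dL: "(L has_derivative L) (at x)" for x using L by (rule linear_imp_has_derivative)
  have cL: "continuous_on X L" for X
    using L linear_continuous_on linear_linear by blast
  have O: "open (L -` U)" using U cL[of UNIV] by (simp add: continuous_on_open_vimage)
  show ?thesis
  proof (rule Ck_open_2I[where f' = "\<lambda>x w. ?F1 (L x) (L w)"
        and f'' = "\<lambda>b x w. \<Sum>c\<in>Basis. (L b \<bullet> c) * ?F2 c (L x) (L w)"])
    show "open (L -` U)" by (rule O)
    fix x assume x: "x \<in> L -` U"
    then show "((\<lambda>x. F (L x)) has_derivative (\<lambda>w. ?F1 (L x) (L w))) (at x)"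
      using diff_chain_at[OF dL F1] by (simp add: o_def)
    fix b :: 'a
    have e: "?F1 (L y) (L b) = (\<Sum>c\<in>Basis. (L b \<bullet> c) * ?F1 (L y) c)" if "y \<in> L -` U" for y
      using has_derivative_Basis_sum[OF F1] that by simp
    have "((\<lambda>y. ?F1 (L y) c) has_derivative (\<lambda>w. ?F2 c (L x) (L w))) (at x)" if "c \<in> Basis" for c
      using diff_chain_at[OF dL F2] that x by (simp add: o_def)
    then have "((\<lambda>y. \<Sum>c\<in>Basis. (L b \<bullet> c) * ?F1 (L y) c) has_derivative
        (\<lambda>w. \<Sum>c\<in>Basis. (L b \<bullet> c) * ?F2 c (L x) (L w))) (at x)"
      by (intro has_derivative_sum has_derivative_mult_right)
    then show "((\<lambda>y. ?F1 (L y) (L b)) has_derivative (\<lambda>w. \<Sum>c\<in>Basis. (L b \<bullet> c) * ?F2 c (L x) (L w))) (at x)"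
      by (rule has_derivative_transform_within_open[OF _ O x]) (simp add: e)
  next
    fix b d :: 'a
    have e: "?F2 c (L x) (L d) = (\<Sum>e\<in>Basis. (L d \<bullet> e) * ?F2 c (L x) e)" if "c \<in> Basis" "x \<in> L -` U" for c x
      using has_derivative_Basis_sum[OF F2] that by simp
    have "continuous_on (L -` U) (\<lambda>x. ?F2 c (L x) e)" if "c \<in> Basis" "e \<in> Basis" for c e
      using F3[OF that] cL by (rule continuous_on_compose2) auto
    then have "continuous_on (L -` U) (\<lambda>x. \<Sum>c\<in>Basis. (L b \<bullet> c) * (\<Sum>e\<in>Basis. (L d \<bullet> e) * ?F2 c (L x) e))"
      by (intro continuous_intros)
    then show "continuous_on (L -` U) (\<lambda>x. \<Sum>c\<in>Basis. (L b \<bullet> c) * ?F2 c (L x) (L d))"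
      by (rule continuous_on_eq) (intro sum.cong, auto simp: e)
  qed
qed

lemma Ck_open_2_ln:
  fixes F :: "'a::euclidean_space \<Rightarrow> real"
  assumes F: "Ck_open 2 U F" and U: "open U" and pos: "\<And>x. x \<in> U \<Longrightarrow> F x > 0"
  shows "Ck_open 2 U (\<lambda>x. ln (F x))"
proof -
  note F1 = Ck_open_2E(1)[OF F] and F2 = Ck_open_2E(2)[OF F] and F3 = Ck_open_2E(3)[OF F]
  note F4 = Ck_open_2E(4)[OF F]
  let ?F1 = "\<lambda>y. frechet_derivative F (at y)"
  let ?F2 = "\<lambda>c y. frechet_derivative (\<lambda>y. ?F1 y c) (at y)"
  show ?thesis
  proof (rule Ck_open_2I[OF U, where f' = "\<lambda>x w. ?F1 x w / F x"
        and f'' = "\<lambda>b x w. ?F2 b x w / F x - ?F1 x b * ?F1 x w / (F x)\<^sup>2"])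
    fix x assume x: "x \<in> U"
    show "((\<lambda>x. ln (F x)) has_derivative (\<lambda>w. ?F1 x w / F x)) (at x)"
      using pos[OF x] F1[OF x] by (auto intro!: derivative_eq_intros simp: field_simps)
    fix b :: 'a assume b: "b \<in> Basis"
    show "((\<lambda>x. ?F1 x b / F x) has_derivative (\<lambda>w. ?F2 b x w / F x - ?F1 x b * ?F1 x w / (F x)\<^sup>2)) (at x)"
      using pos[OF x] F1[OF x] F2[OF x b]
      by (auto intro!: derivative_eq_intros simp: field_simps power2_eq_square)
  next
    fix b c :: 'a assume "b \<in> Basis" "c \<in> Basis"
    moreover have "\<forall>x\<in>U. F x \<noteq> 0" "\<forall>x\<in>U. (F x)\<^sup>2 \<noteq> 0" using pos by fastforce+
    ultimately show "continuous_on U (\<lambda>x. ?F2 b x c / F x - ?F1 x b * ?F1 x c / (F x)\<^sup>2)"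
      by (intro continuous_on_diff continuous_on_divide continuous_on_mult continuous_on_power
          F3 F4 Ck_open_imp_continuous_on[OF F])
  qed
qed

lemma Ck_open_2_sum:
  fixes F :: "'i \<Rightarrow> 'a::euclidean_space \<Rightarrow> real"
  assumes F: "\<And>i. i \<in> I \<Longrightarrow> Ck_open 2 U (F i)" and U: "open U"
  shows "Ck_open 2 U (\<lambda>x. \<Sum>i\<in>I. F i x)"
proof -
  note F1 = Ck_open_2E(1)[OF F] and F2 = Ck_open_2E(2)[OF F] and F3 = Ck_open_2E(3)[OF F]
  show ?thesis
    by (rule Ck_open_2I[OF U, where f' = "\<lambda>x w. \<Sum>i\<in>I. frechet_derivative (F i) (at x) w"
          and f'' = "\<lambda>b x w. \<Sum>i\<in>I. frechet_derivative (\<lambda>y. frechet_derivative (F i) (at y) b) (at x) w"])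
       (auto intro!: has_derivative_sum continuous_intros F1 F2 F3)
qed

section \<open>Diffeomorphisms\<close>

lemma inverse_derivative_det_nonzero:
  fixes v w :: "real^'n \<Rightarrow> real^'n"
  assumes v: "(v has_derivative v') (at x)" and w: "(w has_derivative w') (at (v x))"
    and inv: "\<And>y. w (v y) = y"
  shows "det (matrix v') \<noteq> 0"
proof -
  have "((\<lambda>y. w (v y)) has_derivative (w' \<circ> v')) (at x)"
    using diff_chain_at[OF v w] by (simp add: o_def)
  then have "((\<lambda>y. y) has_derivative (w' \<circ> v')) (at x)" by (simp add: inv)
  then have "w' \<circ> v' = id"
    using has_derivative_unique[OF _ has_derivative_ident] by (simp add: id_def)
  moreover have "matrix (w' \<circ> v') = matrix w' ** matrix v'"
    using v w by (intro matrix_compose has_derivative_linear)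
  ultimately have "det (matrix w') * det (matrix v') = det (mat 1 :: real^'n^'n)"
    by (simp add: matrix_id_mat_1 flip: det_mul)
  then show ?thesis by auto
qed

text \<open>On the line through \<open>a\<close> in direction \<open>axis j 1\<close> the component
  has derivative 0, hence is constant; the line meets \<open>b\<close> at parameter
  \<open>b $ j - a $ j\<close>.\<close>

lemma independent_of_arg_if_derivative_zero:
  fixes v :: "real^'n \<Rightarrow> real^'m"
  assumes d: "\<And>x. (v has_derivative v' x) (at x)" and zero: "\<And>x. v' x (axis j 1) $ i = 0"
  shows "independent_of_arg (\<lambda>x. v x $ i) j"
  unfolding independent_of_arg_def
proof (intro allI impI)
  fix a b :: "real^'n" assume ab: "\<forall>k. k \<noteq> j \<longrightarrow> a $ k = b $ k"
  let ?h = "\<lambda>r. v (a + r *\<^sub>R axis j 1) $ i"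
  have "DERIV ?h r :> 0" for r
  proof -
    have "((\<lambda>r. a + r *\<^sub>R axis j 1) has_derivative (\<lambda>r. r *\<^sub>R axis j 1)) (at r)"
      by (auto intro!: derivative_eq_intros)
    from diff_chain_at[OF this d]
    have "((\<lambda>r. v (a + r *\<^sub>R axis j 1)) has_derivative
        (\<lambda>q. v' (a + r *\<^sub>R axis j 1) (q *\<^sub>R axis j 1))) (at r)"
      by (simp add: o_def)
    then have "(?h has_derivative (\<lambda>q. v' (a + r *\<^sub>R axis j 1) (q *\<^sub>R axis j 1) $ i)) (at r)"
      by (rule bounded_linear.has_derivative[OF bounded_linear_vec_nth])
    moreover have "v' y (q *\<^sub>R axis j 1) $ i = 0" for q y
      using zero[of y] linear_scale[OF has_derivative_linear[OF d[of y]]] by simp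
    ultimately show ?thesis by (simp add: has_field_derivative_def lambda_zero)
  qed
  then have "?h 0 = ?h (b $ j - a $ j)" by (metis DERIV_isconst_all)
  moreover have "a + (b $ j - a $ j) *\<^sub>R axis j 1 = b"
    using ab by (auto simp: vec_eq_iff axis_def)
  ultimately show "v a $ i = v b $ i" by simp
qed

lemma det_nonzero_obtains_permutation:
  fixes M :: "real^'n^'n"
  assumes "det M \<noteq> 0"
  obtains p where "bij p" "\<And>i. M $ p i $ i \<noteq> 0"
proof -
  \<comment> \<open>The permutation of the Leibniz sum selects columns; passing to the transpose
    makes it select rows, as \<open>M $ p i $ i\<close> requires.\<close>
  have "det (transpose M) \<noteq> 0" using assms by (simp add: det_transpose)
  then obtain p where "p permutes (UNIV :: 'n set)" "(\<Prod>i\<in>UNIV. transpose M $ i $ p i) \<noteq> 0"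
    unfolding det_def by (metis (no_types, lifting) mem_Collect_eq mult_zero_right sum.neutral)
  then show ?thesis
    using that[of p] permutes_bij by (auto simp: transpose_def)
qed

lemma entanglement_diffeo:
  fixes f f' :: "real^'z \<Rightarrow> real^'x"
  assumes f: "diffeo_onto_image f" and f': "diffeo_onto_image f'" and r: "range f = range f'"
  shows "bij (inv f \<circ> f')" "Ck_open 1 UNIV (inv f \<circ> f')" "inv (inv f \<circ> f') = inv f' \<circ> f"
proof -
  have inj: "inj f" "inj f'" using f f' by (auto simp: diffeo_onto_image_def)
  have i1: "(inv f \<circ> f') ((inv f' \<circ> f) x) = x" and i2: "(inv f' \<circ> f) ((inv f \<circ> f') x) = x" for x
    using inj r by (auto simp: f_inv_into_f) (metis f_inv_into_f inv_f_f rangeI)+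
  show b: "bij (inv f \<circ> f')" using i1 i2 by (metis bijI')
  show "inv (inv f \<circ> f') = inv f' \<circ> f"
    using i1 i2 by (intro inv_equality) auto
  \<comment> \<open>The range of \<open>f\<close> may have empty interior, and \<open>inv f\<close>
    is arbitrary off it. The chain rule is therefore applied to a C-1 extension \<open>F\<close> on
    an open neighbourhood, which agrees with \<open>inv f\<close> along \<open>f'\<close> because
    the ranges coincide.\<close>
  obtain F U where U: "open U" "range f \<subseteq> U" "Ck_open 1 U F" "\<forall>x\<in>range f. F x = inv f x"
    using f by (auto simp: diffeo_onto_image_def Ck_on_def Ck_extension_def)
  have "Ck_open 1 UNIV (\<lambda>x. F (f' x))"
    using f' U r by (intro Ck_open_1_compose[OF U(3)]) (auto simp: diffeo_onto_image_def Ck_on_UNIV_iff)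
  moreover have "(\<lambda>x. F (f' x)) = inv f \<circ> f'" using U r by auto
  ultimately show "Ck_open 1 UNIV (inv f \<circ> f')" by simp
qed

section \<open>Transition densities and the latent law\<close>

text \<open>The basis vectors of the space of trajectories are the \<open>axis t (axis k 1)\<close>;
  over these, both densities are the same product of one-dimensional Gaussians.\<close>

lemma std_noise_eq_std_gaussian: "std_noise = std_gaussian"
  unfolding std_noise_def std_gaussian_def
  by (intro arg_cong2[where f = density] refl ext) (simp add: prod_Basis_vec inner_axis)

lemma aux_histI: "(\<And>s. as $ s \<in> A) \<Longrightarrow> as \<in> aux_hist A t"
  by (simp add: aux_hist_def)

lemma dens_pos: "graphical_latent_model A \<theta> \<Longrightarrow> as \<in> aux_hist A t \<Longrightarrow> dens \<theta> t i y zs as > 0"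
  by (simp add: graphical_latent_model_def)

lemma dens_history:
  assumes "graphical_latent_model A \<theta>" "as \<in> aux_hist A t" "as' \<in> aux_hist A t"
    and "\<And>s. s < t \<Longrightarrow> zs $ s = zs' $ s"
    and "\<And>s l. s \<le> t \<Longrightarrow> Ga \<theta> $ i $ l = 1 \<Longrightarrow> as $ s $ l = as' $ s $ l"
  shows "dens \<theta> t i y zs as = dens \<theta> t i y zs' as'"
proof -
  have "\<forall>t i zs zs'. \<forall>as \<in> aux_hist A t. \<forall>as' \<in> aux_hist A t.
        (\<forall>j. Gz \<theta> $ i $ j = 1 \<longrightarrow> (\<forall>s<t. zs $ s $ j = zs' $ s $ j)) \<longrightarrow>
        (\<forall>l. Ga \<theta> $ i $ l = 1 \<longrightarrow> (\<forall>s\<le>t. as $ s $ l = as' $ s $ l)) \<longrightarrow>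
        (\<forall>y. dens \<theta> t i y zs as = dens \<theta> t i y zs' as')"
    using assms(1) unfolding graphical_latent_model_def by blast
  then show ?thesis using assms(2-) by simp
qed

lemma trans_dens_pos: "graphical_latent_model A \<theta> \<Longrightarrow> as \<in> aux_hist A t \<Longrightarrow> trans_dens \<theta> t z zs as > 0"
  unfolding trans_dens_def by (intro prod_pos) (simp add: dens_pos)

lemma trans_dens_history:
  assumes "graphical_latent_model A \<theta>" "as \<in> aux_hist A t" "as' \<in> aux_hist A t"
    and "\<And>s. s < t \<Longrightarrow> zs $ s = zs' $ s" and "\<And>s. s \<le> t \<Longrightarrow> as $ s = as' $ s"
  shows "trans_dens \<theta> t z zs as = trans_dens \<theta> t z zs' as'"
  unfolding trans_dens_def
  by (intro prod.cong refl dens_history[OF assms(1-3)]) (simp_all add: assms(4,5))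

lemma measurable_trans_dens:
  assumes m: "graphical_latent_model A \<theta>" "as \<in> aux_hist A t"
    and g: "g \<in> borel_measurable M" and h: "h \<in> borel_measurable M"
  shows "(\<lambda>w. trans_dens \<theta> t (g w) (h w) as) \<in> borel_measurable M"
  unfolding trans_dens_def
proof (rule borel_measurable_prod)
  fix i
  have "(\<lambda>(y, zs). dens \<theta> t i y zs as) \<in> borel_measurable borel"
    using m unfolding graphical_latent_model_def by blast
  moreover have "(\<lambda>w. (g w $ i, h w)) \<in> borel_measurable M"
    by (intro borel_measurable_Pair measurable_compose[OF g measurable_vec_nth] h)
  ultimately show "(\<lambda>w. dens \<theta> t i (g w $ i) (h w) as) \<in> borel_measurable M"
    using measurable_compose[of "\<lambda>w. (g w $ i, h w)" M borel "\<lambda>(y, zs). dens \<theta> t i y zs as" borel]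
    by simp
qed

lemma nn_integral_trans_dens:
  assumes m: "graphical_latent_model A \<theta>" "as \<in> aux_hist A t"
  shows "(\<integral>\<^sup>+ z. ennreal (trans_dens \<theta> t z zs as) \<partial>lborel) = 1"
proof -
  have meas: "(\<lambda>y. dens \<theta> t i y zs as) \<in> borel_measurable borel" for i
  proof -
    have "(\<lambda>(y, zs). dens \<theta> t i y zs as) \<in> borel_measurable borel"
      using m unfolding graphical_latent_model_def by blast
    moreover have "(\<lambda>y :: real. (y, zs)) \<in> borel_measurable borel"
      by (intro borel_measurable_Pair) auto
    ultimately show ?thesis
      using measurable_compose[of "\<lambda>y. (y, zs)" borel borel "\<lambda>(y, zs). dens \<theta> t i y zs as" borel]
      by simp
  qed
  have int: "(\<integral>\<^sup>+ y. ennreal (dens \<theta> t i y zs as) \<partial>lborel) = 1" for i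
    using m unfolding graphical_latent_model_def by blast
  have "(\<integral>\<^sup>+ z. ennreal (trans_dens \<theta> t z zs as) \<partial>lborel)
      = (\<integral>\<^sup>+ z. (\<Prod>i\<in>UNIV. ennreal (dens \<theta> t i (z $ i) zs as)) \<partial>lborel)"
    unfolding trans_dens_def using dens_pos[OF m]
    by (intro nn_integral_cong, subst prod_ennreal) (auto intro: less_imp_le)
  also have "\<dots> = (\<Prod>i\<in>UNIV. \<integral>\<^sup>+ y. ennreal (dens \<theta> t i y zs as) \<partial>lborel)"
    by (rule nn_integral_vec_prod) (use meas in measurable)
  finally show ?thesis by (simp add: int)
qed

lemma continuous_trans_dens:
  assumes c: "C2_factors A \<theta>" and a: "as \<in> aux_hist A t"
    and g: "continuous_on X g" and h: "continuous_on X h"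
  shows "continuous_on X (\<lambda>w. trans_dens \<theta> t (g w) (h w) as)"
  unfolding trans_dens_def
proof (rule continuous_on_prod)
  fix i
  have "continuous_on (UNIV \<times> UNIV \<times> aux_hist A t) (\<lambda>(y, zs, as). dens \<theta> t i y zs as)"
    using c unfolding C2_factors_def by (blast intro: Ck_on_imp_continuous_on)
  moreover have "continuous_on X (\<lambda>w. (g w $ i, h w, as))"
    using g h by (intro continuous_intros)
  ultimately show "continuous_on X (\<lambda>w. dens \<theta> t i (g w $ i) (h w) as)"
    using a continuous_on_compose2[of "UNIV \<times> UNIV \<times> aux_hist A t" "\<lambda>(y, zs, as). dens \<theta> t i y zs as" X "\<lambda>w. (g w $ i, h w, as)"]
    by auto
qed

text \<open>The column of the latest time in \<open>S\<close> occurs in no factor but its own, so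
  integrating it first removes one factor of integral 1. General sets \<open>S\<close> of times make
  this an induction; the case \<open>UNIV\<close> is the total mass of the latent law.\<close>

lemma nn_integral_latent_trajectory:
  fixes \<theta> :: "('x::finite, 'z::finite, 'a::finite, 't::{finite,linorder}) glm"
  assumes m: "graphical_latent_model A \<theta>" and a: "\<And>s. as $ s \<in> A"
  shows "(\<integral>\<^sup>+ w. (\<Prod>t\<in>S. ennreal (trans_dens \<theta> t (w t) (\<chi> s. if s \<in> S then w s else 0) as))
    \<partial>(\<Pi>\<^sub>M t\<in>S. lborel)) = 1"
  using finite[of S]
proof (induction S rule: finite_linorder_max_induct)
  case empty
  interpret product_sigma_finite "\<lambda>_::'t. lborel :: (real^'z) measure" ..
  show ?case by (simp add: space_PiM_empty)
next
  case (insert b S)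
  interpret product_sigma_finite "\<lambda>_::'t. lborel :: (real^'z) measure" ..
  \<comment> \<open>Columns outside \<open>S\<close> are frozen at 0; any value would do, since a
    transition density integrates to 1 whatever the history.\<close>
  let ?ext = "\<lambda>S w. (\<chi> s. if s \<in> S then w s else 0) :: real^'z^'t::_"
  let ?q = "\<lambda>S w. \<Prod>t\<in>S. ennreal (trans_dens \<theta> t (w t) (?ext S w) as)"
  have b: "b \<notin> S" using insert.hyps(2) by auto
  have meas: "?q S' \<in> borel_measurable (\<Pi>\<^sub>M t\<in>S'. lborel)" for S'
  proof (intro borel_measurable_prod_ennreal measurable_compose[OF _ measurable_ennreal]
        measurable_trans_dens[OF m] aux_histI a)
    fix t assume "t \<in> S'"
    then show "(\<lambda>w. w t) \<in> borel_measurable (\<Pi>\<^sub>M t\<in>S'. lborel)" by simp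
    show "?ext S' \<in> borel_measurable (\<Pi>\<^sub>M t\<in>S'. lborel)"
    proof (rule measurable_vec_lambda)
      fix s show "(\<lambda>w. if s \<in> S' then w s else 0) \<in> borel_measurable (\<Pi>\<^sub>M t\<in>S'. lborel)"
        by (cases "s \<in> S'") auto
    qed
  qed
  have "(\<integral>\<^sup>+ w. ?q (insert b S) w \<partial>(\<Pi>\<^sub>M t\<in>insert b S. lborel))
      = (\<integral>\<^sup>+ w. (\<integral>\<^sup>+ y. ?q (insert b S) (w(b := y)) \<partial>lborel) \<partial>(\<Pi>\<^sub>M t\<in>S. lborel))"
    using insert.hyps(1) b by (intro product_nn_integral_insert meas)
  also have "\<dots> = (\<integral>\<^sup>+ w. ?q S w \<partial>(\<Pi>\<^sub>M t\<in>S. lborel))"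
  proof (rule nn_integral_cong)
    fix w :: "'t \<Rightarrow> real^'z"
    \<comment> \<open>\<open>b\<close> exceeds all of \<open>S\<close>, so column \<open>b\<close>
      belongs neither to its own history nor to that of any \<open>t \<in> S\<close>.\<close>
    have "?q (insert b S) (w(b := y)) = ?q S w * ennreal (trans_dens \<theta> b y (?ext S w) as)" for y
    proof -
      have "trans_dens \<theta> b y (?ext (insert b S) (w(b := y))) as = trans_dens \<theta> b y (?ext S w) as"
        by (rule trans_dens_history[OF m]) (auto intro!: aux_histI a)
      moreover have "trans_dens \<theta> t ((w(b := y)) t) (?ext (insert b S) (w(b := y))) as
          = trans_dens \<theta> t (w t) (?ext S w) as" if "t \<in> S" for t
      proof -
        have "t < b" using insert.hyps(2) that by blast
        then have "trans_dens \<theta> t (w t) (?ext (insert b S) (w(b := y))) as = trans_dens \<theta> t (w t) (?ext S w) as"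
          by (intro trans_dens_history[OF m]) (auto intro!: aux_histI a)
        with \<open>t < b\<close> show ?thesis by auto
      qed
      ultimately show ?thesis
        using insert.hyps(1) b by (simp add: mult.commute cong: prod.cong)
    qed
    then have "(\<integral>\<^sup>+ y. ?q (insert b S) (w(b := y)) \<partial>lborel)
        = (\<integral>\<^sup>+ y. ?q S w * ennreal (trans_dens \<theta> b y (?ext S w) as) \<partial>lborel)"
      by simp
    also have "\<dots> = ?q S w * (\<integral>\<^sup>+ y. ennreal (trans_dens \<theta> b y (?ext S w) as) \<partial>lborel)"
      by (rule nn_integral_cmult)
        (intro measurable_compose[OF _ measurable_ennreal] measurable_trans_dens[OF m] aux_histI a, auto)
    also have "\<dots> = ?q S w"
      by (simp add: nn_integral_trans_dens[OF m aux_histI[OF a]])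
    finally show "(\<integral>\<^sup>+ y. ?q (insert b S) (w(b := y)) \<partial>lborel) = ?q S w" .
  qed
  also have "\<dots> = 1" by (rule insert.IH)
  finally show ?case .
qed

lemma measurable_joint_dens:
  fixes \<theta> :: "('x::finite, 'z::finite, 'a::finite, 't::{finite,linorder}) glm"
  assumes m: "graphical_latent_model A \<theta>" and a: "\<And>s. as $ s \<in> A"
  shows "(\<lambda>zs. \<Prod>t\<in>UNIV. trans_dens \<theta> t (zs $ t) zs as) \<in> borel_measurable borel"
  by (intro borel_measurable_prod measurable_trans_dens[OF m] aux_histI a) auto

lemma prob_space_latent_law:
  fixes \<theta> :: "('x::finite, 'z::finite, 'a::finite, 't::{finite,linorder}) glm"
  assumes m: "graphical_latent_model A \<theta>" and a: "\<And>s. as $ s \<in> A"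
  shows "prob_space (latent_law \<theta> as)"
proof
  let ?q = "\<lambda>zs. \<Prod>t\<in>UNIV. trans_dens \<theta> t (zs $ t) zs as"
  have q: "?q \<in> borel_measurable borel" by (rule measurable_joint_dens[OF m a])
  have vl: "(\<lambda>w :: 't \<Rightarrow> real^'z. \<chi> t. w t) \<in> borel_measurable (\<Pi>\<^sub>M t\<in>UNIV. lborel)"
    by (intro measurable_vec_lambda) simp
  have "emeasure (latent_law \<theta> as) (space (latent_law \<theta> as)) = (\<integral>\<^sup>+ zs. ennreal (?q zs) \<partial>lborel)"
    using q by (simp add: latent_law_def emeasure_density)
  also have "\<dots> = (\<integral>\<^sup>+ w. ennreal (?q (\<chi> t. w t)) \<partial>(\<Pi>\<^sub>M t\<in>UNIV. lborel))"
    using q by (subst lborel_vec, subst nn_integral_distr[OF vl]) auto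
  also have "\<dots> = 1"
    using nn_integral_latent_trajectory[OF m a, of UNIV]
    by (simp add: prod_ennreal less_imp_le[OF trans_dens_pos[OF m aux_histI[OF a]]])
  finally show "emeasure (latent_law \<theta> as) (space (latent_law \<theta> as)) = 1" .
qed

section \<open>From observations to latents\<close>

lemma continuous_mixing: "graphical_latent_model A \<theta> \<Longrightarrow> continuous_on UNIV (mixing \<theta>)"
  by (auto simp: graphical_latent_model_def diffeo_onto_image_def intro: Ck_on_imp_continuous_on)

lemma measurable_mixing_columns:
  assumes m: "graphical_latent_model A (\<theta> :: ('x::finite, 'z::finite, 'a::finite, 't::{finite,linorder}) glm)"
  shows "(\<lambda>zs :: real^'z^'s::finite. \<chi> t. mixing \<theta> (zs $ t)) \<in> borel_measurable borel"
  by (intro measurable_vec_lambda measurable_compose[OF measurable_vec_nth]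
      borel_measurable_continuous_onI continuous_mixing[OF m])

lemma sets_latent_law [simp, measurable_cong]: "sets (latent_law \<theta> as) = sets borel"
  by (simp add: latent_law_def)

lemma noiseless_law_eq:
  fixes \<theta> \<theta>' :: "('x::finite, 'z::finite, 'a::finite, 't::{finite,linorder}) glm"
  assumes m: "graphical_latent_model A \<theta>" "graphical_latent_model A \<theta>'"
    and obs: "obs_equiv A \<sigma>2 \<theta> \<theta>'" and a: "\<And>s. as $ s \<in> A"
  shows "distr (latent_law \<theta> as) borel (\<lambda>zs. \<chi> t. mixing \<theta> (zs $ t))
       = distr (latent_law \<theta>' as) borel (\<lambda>zs. \<chi> t. mixing \<theta>' (zs $ t))"
proof (rule gaussian_deconvolution[where c = "sqrt \<sigma>2"])
  have "obs_law \<sigma>2 \<theta> as = obs_law \<sigma>2 \<theta>' as" using obs a by (auto simp: obs_equiv_def)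
  moreover have "(\<lambda>(zs :: real^'z^'t::_, n). \<chi> t. f (zs $ t) + sqrt \<sigma>2 *\<^sub>R n $ t)
      = (\<lambda>(zs, n). (\<chi> t. f (zs $ t)) + sqrt \<sigma>2 *\<^sub>R n)" for f :: "real^'z \<Rightarrow> real^'x"
    by (auto simp: vec_eq_iff fun_eq_iff)
  ultimately show "distr (latent_law \<theta> as \<Otimes>\<^sub>M std_gaussian) borel
        (\<lambda>(zs, n). (\<chi> t. mixing \<theta> (zs $ t)) + sqrt \<sigma>2 *\<^sub>R n)
      = distr (latent_law \<theta>' as \<Otimes>\<^sub>M std_gaussian) borel
        (\<lambda>(zs, n). (\<chi> t. mixing \<theta>' (zs $ t)) + sqrt \<sigma>2 *\<^sub>R n)"
    by (simp add: obs_law_def std_noise_eq_std_gaussian)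
qed (use measurable_mixing_columns[OF m(1)] measurable_mixing_columns[OF m(2)]
      prob_space_latent_law[OF m(1) a] prob_space_latent_law[OF m(2) a] in \<open>simp_all cong: measurable_cong_sets\<close>)

text \<open>The trajectories that the second model maps outside the closed range of the first at a
  given time form an open set. It has probability 0, since the noiseless laws agree, while the
  latent density is positive everywhere; so it is empty.\<close>

lemma range_mixing_subset:
  fixes \<theta> \<theta>' :: "('x::finite, 'z::finite, 'a::finite, 't::{finite,linorder}) glm"
  assumes m: "graphical_latent_model A \<theta>" "graphical_latent_model A \<theta>'"
    and eq: "distr (latent_law \<theta> as) borel (\<lambda>zs. \<chi> t. mixing \<theta> (zs $ t))
       = distr (latent_law \<theta>' as) borel (\<lambda>zs. \<chi> t. mixing \<theta>' (zs $ t))"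
    and a: "\<And>s. as $ s \<in> A"
  shows "range (mixing \<theta>') \<subseteq> range (mixing \<theta>)"
proof (rule ccontr)
  assume "\<not> ?thesis"
  then obtain z where z: "mixing \<theta>' z \<notin> range (mixing \<theta>)" by auto
  \<comment> \<open>Any time serves here; the type of times is nonempty.\<close>
  fix t :: 't
  let ?F = "\<lambda>\<theta> :: ('x, 'z, 'a, 't) glm. \<lambda>zs :: real^'z^'t::_. \<chi> t. mixing \<theta> (zs $ t)"
  let ?E = "(\<lambda>X :: real^'x^'t::_. X $ t) -` (- range (mixing \<theta>))"
  have cl: "closed (range (mixing \<theta>))" using m(1) by (simp add: graphical_latent_model_def)
  have E: "?E \<in> sets borel"
    using cl by (intro measurable_sets_borel[OF measurable_vec_nth]) auto
  define U where "U = ?F \<theta>' -` ?E"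
  have "open U"
  proof -
    have "open ((\<lambda>zs :: real^'z^'t::_. mixing \<theta>' (zs $ t)) -` (- range (mixing \<theta>)))"
      using cl
      by (intro open_vimage continuous_on_compose2[OF continuous_mixing[OF m(2)]] continuous_intros) auto
    moreover have "U = (\<lambda>zs :: real^'z^'t::_. mixing \<theta>' (zs $ t)) -` (- range (mixing \<theta>))"
      by (auto simp: U_def)
    ultimately show ?thesis by simp
  qed
  have "emeasure (latent_law \<theta>' as) U = emeasure (distr (latent_law \<theta>' as) borel (?F \<theta>')) ?E"
    using E measurable_mixing_columns[OF m(2)]
    by (subst emeasure_distr) (auto simp: U_def latent_law_def)
  also have "\<dots> = emeasure (distr (latent_law \<theta> as) borel (?F \<theta>)) ?E" by (simp add: eq)
  also have "\<dots> = emeasure (latent_law \<theta> as) (?F \<theta> -` ?E)"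
    using E measurable_mixing_columns[OF m(1)]
    by (subst emeasure_distr) (auto simp: latent_law_def)
  also have "?F \<theta> -` ?E = {}" by auto
  finally have "U \<in> null_sets (latent_law \<theta>' as)"
    using \<open>open U\<close> by (auto intro: null_setsI)
  then have "AE zs in lborel. zs \<in> U \<longrightarrow> ennreal (\<Prod>t\<in>UNIV. trans_dens \<theta>' t (zs $ t) zs as) = 0"
    using measurable_joint_dens[OF m(2) a] unfolding latent_law_def
    by (subst (asm) null_sets_density_iff) auto
  moreover have "\<not> (\<Prod>t\<in>UNIV. trans_dens \<theta>' t (zs $ t) zs as) \<le> 0" for zs
    unfolding not_le by (intro prod_pos) (simp add: trans_dens_pos[OF m(2) aux_histI[OF a]])
  ultimately have "AE zs in lborel. zs \<notin> U" by (simp add: ennreal_eq_0_iff)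
  then have "U = {}" by (intro open_empty_if_AE_not_in \<open>open U\<close> AE_completion)
  moreover have "(\<chi> t. z) \<in> U" using z by (auto simp: U_def)
  ultimately show False by blast
qed

lemma entanglement_map_facts:
  fixes \<theta> \<theta>' :: "('x::finite, 'z::finite, 'a::finite, 't::{finite,linorder}) glm"
  assumes m: "graphical_latent_model A \<theta>" "graphical_latent_model A \<theta>'"
    and r: "range (mixing \<theta>) = range (mixing \<theta>')"
  defines "v \<equiv> entanglement_map \<theta> \<theta>'"
  shows "bij v" "Ck_open 1 UNIV v" "Ck_open 1 UNIV (inv v)"
    and "(v has_derivative frechet_derivative v (at z)) (at z)"
    and "continuous_on UNIV (\<lambda>z. jacobian v (at z) $ i $ j)"
    and "continuous_on UNIV (\<lambda>z. \<bar>det (jacobian v (at z))\<bar>)"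
    and "det (jacobian v (at z)) \<noteq> 0"
    and "mixing \<theta> (v z) = mixing \<theta>' z"
proof -
  have d: "diffeo_onto_image (mixing \<theta>)" "diffeo_onto_image (mixing \<theta>')"
    using m by (auto simp: graphical_latent_model_def)
  note e = entanglement_diffeo[OF d r, folded entanglement_map_def, folded v_def]
    and e' = entanglement_diffeo[OF d(2,1) r[symmetric]]
  show b: "bij v" and c: "Ck_open 1 UNIV v" by (fact e)+
  show c': "Ck_open 1 UNIV (inv v)"
    unfolding e(3) entanglement_map_def by (fact e')
  show der: "(v has_derivative frechet_derivative v (at z)) (at z)" for z
    using c by (intro Ck_open_Suc_has_derivative[of 0 UNIV]) auto
  show cj: "continuous_on UNIV (\<lambda>z. jacobian v (at z) $ i $ j)" for i j
  proof -
    have "continuous_on UNIV (\<lambda>z. frechet_derivative v (at z) (axis j 1))"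
      using c by (auto simp: axis_in_Basis_iff)
    then show ?thesis by (simp add: jacobian_def matrix_def continuous_on_component)
  qed
  show "continuous_on UNIV (\<lambda>z. \<bar>det (jacobian v (at z))\<bar>)"
    unfolding det_def by (intro continuous_intros cj)
  have "((inv v) has_derivative frechet_derivative (inv v) (at y)) (at y)" for y
    using c' by (intro Ck_open_Suc_has_derivative[of 0 UNIV]) auto
  then show "det (jacobian v (at z)) \<noteq> 0"
    unfolding jacobian_def using b
    by (intro inverse_derivative_det_nonzero[OF der]) (auto simp: bij_def)
  show "mixing \<theta> (v z) = mixing \<theta>' z"
    unfolding v_def entanglement_map_def using r by (simp add: f_inv_into_f)
qed

text \<open>A Borel left inverse of \<open>mixing \<theta>\<close>, applied columnwise to the two
  noiseless observation laws, returns the latents of the first model and the images under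
  \<open>v\<close> of those of the second.\<close>

lemma latent_law_pullback:
  fixes \<theta> \<theta>' :: "('x::finite, 'z::finite, 'a::finite, 't::{finite,linorder}) glm"
  assumes m: "graphical_latent_model A \<theta>" "graphical_latent_model A \<theta>'"
    and r: "range (mixing \<theta>) = range (mixing \<theta>')"
    and eq: "distr (latent_law \<theta> as) borel (\<lambda>zs. \<chi> t. mixing \<theta> (zs $ t))
       = distr (latent_law \<theta>' as) borel (\<lambda>zs. \<chi> t. mixing \<theta>' (zs $ t))"
  shows "latent_law \<theta> as = distr (latent_law \<theta>' as) borel (\<lambda>zs. \<chi> t. entanglement_map \<theta> \<theta>' (zs $ t))"
proof -
  let ?F = "\<lambda>\<theta> :: ('x, 'z, 'a, 't) glm. \<lambda>zs :: real^'z^'t::_. \<chi> t. mixing \<theta> (zs $ t)"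
  let ?f = "mixing \<theta>"
  have d: "diffeo_onto_image ?f" and cl: "closed (range ?f)"
    using m by (auto simp: graphical_latent_model_def)
  \<comment> \<open>\<open>inv ?f\<close> is meaningful on the range only. The value 0 elsewhere
    keeps \<open>h\<close> Borel, because the range is closed and \<open>inv ?f\<close> is
    continuous on it.\<close>
  define h where "h x = (if x \<in> range ?f then inv ?f x else 0)" for x
  have "continuous_on (range ?f) (inv ?f)"
    using d by (auto simp: diffeo_onto_image_def intro: Ck_on_imp_continuous_on)
  then have "h \<in> borel_measurable borel"
    unfolding h_def using cl by (intro borel_measurable_continuous_on_if) auto
  then have H: "(\<lambda>X :: real^'x^'t::_. \<chi> t. h (X $ t)) \<in> borel_measurable borel"
    by (intro measurable_vec_lambda measurable_compose[OF measurable_vec_nth])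
  have 1: "(\<lambda>X. \<chi> t. h (X $ t)) \<circ> ?F \<theta> = (\<lambda>zs. zs)"
    using d by (auto simp: h_def fun_eq_iff vec_eq_iff diffeo_onto_image_def)
  have 2: "(\<lambda>X. \<chi> t. h (X $ t)) \<circ> ?F \<theta>' = (\<lambda>zs. \<chi> t. entanglement_map \<theta> \<theta>' (zs $ t))"
    using r by (auto simp: h_def fun_eq_iff vec_eq_iff entanglement_map_def)
  have "distr (distr (latent_law \<theta> as) borel (?F \<theta>)) borel (\<lambda>X. \<chi> t. h (X $ t)) = latent_law \<theta> as"
    using measurable_mixing_columns[OF m(1)]
    by (subst distr_distr[OF H]) (auto simp: 1 latent_law_def intro!: distr_id2)
  moreover have "distr (distr (latent_law \<theta>' as) borel (?F \<theta>')) borel (\<lambda>X. \<chi> t. h (X $ t))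
      = distr (latent_law \<theta>' as) borel (\<lambda>zs. \<chi> t. entanglement_map \<theta> \<theta>' (zs $ t))"
    using measurable_mixing_columns[OF m(2)]
    by (subst distr_distr[OF H]) (auto simp: 2 latent_law_def)
  ultimately show ?thesis using eq by metis
qed

text \<open>Undoing the pushforward along \<open>v\<close> by the Jacobian formula gives the second
  latent law the density \<open>q\<close>. Two densities of the same measure agree almost
  everywhere, and continuity of both makes them equal everywhere.\<close>

lemma joint_dens_eq:
  fixes \<theta> \<theta>' :: "('x::finite, 'z::finite, 'a::finite, 't::{finite,linorder}) glm"
  assumes m: "graphical_latent_model A \<theta>" "graphical_latent_model A \<theta>'"
    and C2: "C2_factors A \<theta>" "C2_factors A \<theta>'"
    and r: "range (mixing \<theta>) = range (mixing \<theta>')"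
    and eq: "distr (latent_law \<theta> as) borel (\<lambda>zs. \<chi> t. mixing \<theta> (zs $ t))
       = distr (latent_law \<theta>' as) borel (\<lambda>zs. \<chi> t. mixing \<theta>' (zs $ t))"
    and a: "\<And>s. as $ s \<in> A"
  defines "v \<equiv> entanglement_map \<theta> \<theta>'"
  shows "(\<Prod>t\<in>UNIV. trans_dens \<theta>' t (zs $ t) zs as)
    = (\<Prod>t\<in>UNIV. trans_dens \<theta> t (v (zs $ t)) (\<chi> s. v (zs $ s)) as * \<bar>det (jacobian v (at (zs $ t)))\<bar>)"
proof -
  note ev = entanglement_map_facts[OF m r, folded v_def]
  let ?J = "\<lambda>z. \<bar>det (jacobian v (at z))\<bar>"
  let ?V = "\<lambda>zs :: real^'z^'t::_. \<chi> t. v (zs $ t)"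
  let ?W = "\<lambda>zs :: real^'z^'t::_. \<chi> t. inv v (zs $ t)"
  let ?q = "\<lambda>\<theta> :: ('x, 'z, 'a, 't) glm. \<lambda>zs. \<Prod>t\<in>UNIV. trans_dens \<theta> t (zs $ t) zs as"
  have cv: "continuous_on UNIV v" and cw: "continuous_on UNIV (inv v)"
    by (rule Ck_open_imp_continuous_on[OF ev(2)], rule Ck_open_imp_continuous_on[OF ev(3)])
  have cV: "continuous_on UNIV ?V"
    by (intro continuous_on_vec_lambda continuous_on_compose2[OF cv] continuous_intros) auto
  have cq: "continuous_on UNIV (?q \<theta>)" "continuous_on UNIV (?q \<theta>')"
    by (intro continuous_on_prod continuous_trans_dens[OF C2(1)] continuous_trans_dens[OF C2(2)]
        aux_histI a continuous_intros)+
  have cJ: "continuous_on UNIV (\<lambda>zs :: real^'z^'t::_. ?J (zs $ t))" for t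
    by (rule continuous_on_compose2[OF ev(6)]) (auto intro: continuous_intros)
  define q where "q zs = ?q \<theta> (?V zs) * (\<Prod>t\<in>UNIV. ?J (zs $ t))" for zs
  have cqV: "continuous_on UNIV q"
    unfolding q_def by (intro continuous_intros continuous_on_compose2[OF cq(1) cV] cJ) auto
  have mJ: "?J \<in> borel_measurable borel" using ev(6) by (rule borel_measurable_continuous_onI)
  have mV: "?V \<in> borel_measurable borel" using cV by (rule borel_measurable_continuous_onI)
  have mW: "?W \<in> borel_measurable borel"
    by (intro borel_measurable_continuous_onI continuous_on_vec_lambda continuous_on_compose2[OF cw] continuous_intros) auto
  have WV: "?W (?V zs) = zs" for zs using ev(1) by (simp add: bij_def)
  have mq[measurable]: "?q \<theta> \<in> borel_measurable borel" "?q \<theta>' \<in> borel_measurable borel" "q \<in> borel_measurable borel"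
    using cq cqV by (auto intro: borel_measurable_continuous_onI)
  have q0: "?q \<theta> zs \<ge> 0" for zs
    by (intro prod_nonneg less_imp_le[OF trans_dens_pos[OF m(1)]] aux_histI a)
  have "latent_law \<theta>' as = density lborel (\<lambda>zs. ennreal (q zs))"
  proof (rule measure_eqI)
    fix B assume "B \<in> sets (latent_law \<theta>' as)"
    then have B[measurable]: "B \<in> sets borel" by simp
    have C[measurable]: "?W -` B \<in> sets borel" using measurable_sets_borel[OF mW B] by simp
    \<comment> \<open>Since \<open>?W\<close> is the columnwise inverse, \<open>B\<close> is a
      preimage under \<open>?V\<close>, to which the pushforward identity applies.\<close>
    have "emeasure (latent_law \<theta>' as) B = emeasure (latent_law \<theta>' as) (?V -` (?W -` B))"
      using WV by (auto intro!: arg_cong2[where f = emeasure])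
    also have "\<dots> = emeasure (latent_law \<theta> as) (?W -` B)"
      by (subst latent_law_pullback[OF m r eq, folded v_def], subst emeasure_distr)
        (use mV C in \<open>auto simp: latent_law_def\<close>)
    also have "\<dots> = (\<integral>\<^sup>+ zs. ennreal (?q \<theta> zs) * indicator (?W -` B) zs \<partial>lborel)"
      by (simp add: latent_law_def emeasure_density)
    also have "\<dots> = (\<integral>\<^sup>+ zs. (\<Prod>t\<in>UNIV. ennreal (?J (zs $ t))) * (ennreal (?q \<theta> (?V zs)) * indicator (?W -` B) (?V zs)) \<partial>lborel)"
      by (rule nn_integral_change_of_variables_columns[OF ev(1,4) _ mJ, symmetric])
        (auto simp: jacobian_def)
    also have "\<dots> = (\<integral>\<^sup>+ zs. ennreal (q zs) * indicator B zs \<partial>lborel)"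
    proof (rule nn_integral_cong)
      fix zs :: "real^'z^'t::_"
      have "indicator (?W -` B) (?V zs) = (indicator B zs :: ennreal)"
        using WV[of zs] by (simp add: indicator_def)
      moreover have "(\<Prod>t\<in>UNIV. ennreal (?J (zs $ t))) * ennreal (?q \<theta> (?V zs)) = ennreal (q zs)"
        unfolding q_def using q0[of "?V zs"]
        by (subst prod_ennreal, simp, subst ennreal_mult[symmetric])
           (auto simp: mult.commute intro!: prod_nonneg)
      ultimately show "(\<Prod>t\<in>UNIV. ennreal (?J (zs $ t))) * (ennreal (?q \<theta> (?V zs)) * indicator (?W -` B) (?V zs))
          = ennreal (q zs) * indicator B zs"
        by (simp only: mult.assoc[symmetric])
    qed
    also have "\<dots> = emeasure (density lborel (\<lambda>zs. ennreal (q zs))) B"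
      by (simp add: emeasure_density)
    finally show "emeasure (latent_law \<theta>' as) B = emeasure (density lborel (\<lambda>zs. ennreal (q zs))) B" .
  qed simp
  then have "AE zs in lborel. ennreal (?q \<theta>' zs) = ennreal (q zs)"
    unfolding latent_law_def by (intro sigma_finite_measure.density_unique[OF lborel.sigma_finite_measure_axioms]) auto
  moreover have "q zs \<ge> 0" for zs
    unfolding q_def by (rule mult_nonneg_nonneg[OF q0]) (simp add: prod_nonneg)
  moreover have "?q \<theta>' zs \<ge> 0" for zs
    by (intro prod_nonneg less_imp_le[OF trans_dens_pos[OF m(2)]] aux_histI a)
  ultimately have "AE zs in lborel. ?q \<theta>' zs = q zs" by simp
  then have "?q \<theta>' zs = q zs" by (rule continuous_AE_eq[OF cq(2) cqV])
  then show ?thesis by (simp add: q_def prod.distrib)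
qed

text \<open>Integrating out the last remaining time peels the factors of a joint density off one by one.\<close>

lemma kernels_eq_if_products_eq:
  fixes K K' :: "'t::{finite,linorder} \<Rightarrow> 'b::euclidean_space \<Rightarrow> 'b^'t::_ \<Rightarrow> real"
  assumes pos: "\<And>t z zs. K t z zs > 0" "\<And>t z zs. K' t z zs > 0"
    and meas: "\<And>t zs. (\<lambda>z. K t z zs) \<in> borel_measurable borel" "\<And>t zs. (\<lambda>z. K' t z zs) \<in> borel_measurable borel"
    and int: "\<And>t zs. (\<integral>\<^sup>+ z. ennreal (K t z zs) \<partial>lborel) = 1" "\<And>t zs. (\<integral>\<^sup>+ z. ennreal (K' t z zs) \<partial>lborel) = 1"
    and hist: "\<And>t z zs zs'. (\<And>s. s < t \<Longrightarrow> zs $ s = zs' $ s) \<Longrightarrow> K t z zs = K t z zs'"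
      "\<And>t z zs zs'. (\<And>s. s < t \<Longrightarrow> zs $ s = zs' $ s) \<Longrightarrow> K' t z zs = K' t z zs'"
    and eq: "\<And>zs. (\<Prod>t\<in>UNIV. K t (zs $ t) zs) = (\<Prod>t\<in>UNIV. K' t (zs $ t) zs)"
  shows "K t z zs = K' t z zs"
proof -
  \<comment> \<open>\<open>U\<close> is a set of final times already integrated out. Adding its new
    minimum \<open>b\<close> means integrating over the last remaining column, on which only the
    factor of \<open>b\<close> depends.\<close>
  have tails: "(\<Prod>s\<in>-U. K s (zs $ s) zs) = (\<Prod>s\<in>-U. K' s (zs $ s) zs)"
    if "\<And>u s. u \<in> U \<Longrightarrow> u \<le> s \<Longrightarrow> s \<in> U" for U zs
    using finite[of U] that
  proof (induction U arbitrary: zs rule: finite_linorder_min_induct)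
    case empty
    then show ?case by (simp add: eq)
  next
    case (insert b U)
    let ?S = "- insert b U"
    have S: "- U = insert b ?S" "b \<notin> ?S" "finite ?S" using insert.hyps(2) by auto
    have less: "s < b" if "s \<in> ?S" for s
      using insert.prems[of b s] that by (meson ComplD insertI1 not_le)
    have up: "s \<in> U" if "u \<in> U" "u \<le> s" for u s
      using insert.prems[of u s] insert.hyps(2) that by auto
    have int1: "(\<integral>\<^sup>+ y. ennreal (\<Prod>s\<in>-U. Q s ((\<chi> s. if s = b then y else zs $ s) $ s) (\<chi> s. if s = b then y else zs $ s)) \<partial>lborel)
        = ennreal (\<Prod>s\<in>?S. Q s (zs $ s) zs)"
      if Q: "\<And>t z zs. Q t z zs > 0" "\<And>t zs. (\<lambda>z. Q t z zs) \<in> borel_measurable borel"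
        "\<And>t zs. (\<integral>\<^sup>+ z. ennreal (Q t z zs) \<partial>lborel) = 1"
        "\<And>t z zs zs'. (\<And>s. s < t \<Longrightarrow> zs $ s = zs' $ s) \<Longrightarrow> Q t z zs = Q t z zs'"
      for Q :: "'t \<Rightarrow> 'b \<Rightarrow> 'b^'t::_ \<Rightarrow> real"
    proof -
      let ?zs = "\<lambda>y. (\<chi> s. if s = b then y else zs $ s) :: 'b^'t::_"
      note [measurable] = Q(2)
      have "(\<Prod>s\<in>-U. Q s (?zs y $ s) (?zs y)) = Q b y zs * (\<Prod>s\<in>?S. Q s (zs $ s) zs)" for y
      proof -
        have "Q b y (?zs y) = Q b y zs" by (rule Q(4)) auto
        moreover have "Q s (?zs y $ s) (?zs y) = Q s (zs $ s) zs" if "s \<in> ?S" for s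
        proof -
          have "Q s (zs $ s) (?zs y) = Q s (zs $ s) zs"
            using less[OF that] by (intro Q(4)) auto
          moreover have "s \<noteq> b" using less[OF that] by auto
          ultimately show ?thesis by simp
        qed
        then have "(\<Prod>s\<in>?S. Q s (?zs y $ s) (?zs y)) = (\<Prod>s\<in>?S. Q s (zs $ s) zs)"
          by (rule prod.cong[OF refl])
        ultimately show ?thesis
          unfolding S(1) prod.insert[OF S(3,2)] by simp
      qed
      then have "(\<integral>\<^sup>+ y. ennreal (\<Prod>s\<in>-U. Q s (?zs y $ s) (?zs y)) \<partial>lborel)
          = (\<integral>\<^sup>+ y. ennreal (Q b y zs) * ennreal (\<Prod>s\<in>?S. Q s (zs $ s) zs) \<partial>lborel)"
        using less_imp_le[OF Q(1)] by (simp add: ennreal_mult prod_nonneg)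
      also have "\<dots> = ennreal (\<Prod>s\<in>?S. Q s (zs $ s) zs)"
        by (subst nn_integral_multc) (auto simp: Q(3))
      finally show ?thesis .
    qed
    have IH: "(\<Prod>s\<in>-U. K s (zs $ s) zs) = (\<Prod>s\<in>-U. K' s (zs $ s) zs)" for zs
      by (rule insert.IH) (blast intro: up)
    have "ennreal (\<Prod>s\<in>?S. K s (zs $ s) zs) = ennreal (\<Prod>s\<in>?S. K' s (zs $ s) zs)"
      using int1[of K, OF pos(1) meas(1) int(1) hist(1)]
        int1[of K', OF pos(2) meas(2) int(2) hist(2)]
      by (simp only: IH)
    then show ?case
      using pos by (simp add: prod_nonneg less_imp_le)
  qed
  \<comment> \<open>Putting \<open>z\<close> into column \<open>t\<close> leaves the history before
    \<open>t\<close> unchanged. The products over the times up to \<open>t\<close> and before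
    \<open>t\<close> then differ by the wanted factor alone, and division isolates it.\<close>
  let ?zs = "(\<chi> s. if s = t then z else zs $ s) :: 'b^'t::_"
  have "(\<Prod>s\<in>-{t<..}. K s (?zs $ s) ?zs) = (\<Prod>s\<in>-{t<..}. K' s (?zs $ s) ?zs)"
    by (rule tails) auto
  moreover have "(\<Prod>s\<in>-{t..}. K s (?zs $ s) ?zs) = (\<Prod>s\<in>-{t..}. K' s (?zs $ s) ?zs)"
    by (rule tails) auto
  moreover have "- {t<..} = insert t (- {t..})" by auto
  moreover have "K' s z zs \<noteq> 0" for s z zs using pos(2)[of s z zs] by simp
  ultimately have "K t z ?zs = K' t z ?zs" by simp
  moreover have "K t z ?zs = K t z zs" "K' t z ?zs = K' t z zs"
    by (rule hist; auto)+
  ultimately show ?thesis by simp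
qed

lemma obs_equiv_imp_diff_equiv:
  fixes \<theta> \<theta>' :: "('x::finite, 'z::finite, 'a::finite, 't::{finite,linorder}) glm"
  assumes ne: "A \<noteq> {}" and m: "graphical_latent_model A \<theta>" "graphical_latent_model A \<theta>'"
    and C2: "C2_factors A \<theta>" "C2_factors A \<theta>'" and obs: "obs_equiv A \<sigma>2 \<theta> \<theta>'"
  shows "diff_equiv A \<theta> \<theta>'"
proof -
  obtain a where a: "a \<in> A" using ne by blast
  note law = noiseless_law_eq[OF m obs]
  have ra: "(\<chi> s. a) $ s \<in> A" for s using a by simp
  have r: "range (mixing \<theta>) = range (mixing \<theta>')"
    using range_mixing_subset[OF m law[OF ra] ra] range_mixing_subset[OF m(2,1) law[OF ra, symmetric] ra]
    by blast
  define v where "v = entanglement_map \<theta> \<theta>'"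
  note ev = entanglement_map_facts[OF m r, folded v_def]
  let ?J = "\<lambda>z. \<bar>det (jacobian v (at z))\<bar>"
  have mJ: "?J \<in> borel_measurable borel" using ev(6) by (rule borel_measurable_continuous_onI)
  have mv: "v \<in> borel_measurable borel"
    using ev(4) by (rule borel_measurable_if_has_derivative)
  have "trans_dens \<theta>' t z zs as = trans_dens \<theta> t (v z) (\<chi> s. v (zs $ s)) as * ?J z"
    if as: "as \<in> aux_hist A t" for t z zs as
  proof -
    \<comment> \<open>Observational equivalence speaks of full auxiliary trajectories in
      \<open>A\<close>, whereas \<open>as\<close> is constrained up to \<open>t\<close> only. Later
      columns are replaced by a fixed point of \<open>A\<close>; the densities at time
      \<open>t\<close> do not see them.\<close>
    define bs where "bs = (\<chi> s. if s \<le> t then as $ s else a)"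
    have bs: "bs $ s \<in> A" for s using as a by (auto simp: bs_def aux_hist_def)
    have bs': "bs \<in> aux_hist A t" for t by (rule aux_histI[OF bs])
    have "trans_dens \<theta>' t z zs bs = trans_dens \<theta> t (v z) (\<chi> s. v (zs $ s)) bs * ?J z"
    proof (rule kernels_eq_if_products_eq[where K = "\<lambda>t z zs. trans_dens \<theta>' t z zs bs"
          and K' = "\<lambda>t z zs. trans_dens \<theta> t (v z) (\<chi> s. v (zs $ s)) bs * ?J z"])
      fix t :: 't and z and zs zs' :: "real^'z^'t::_"
      show "trans_dens \<theta>' t z zs bs > 0" "trans_dens \<theta> t (v z) (\<chi> s. v (zs $ s)) bs * ?J z > 0"
        using trans_dens_pos[OF m(1) bs'] trans_dens_pos[OF m(2) bs'] ev(7) by auto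
      show "(\<lambda>z. trans_dens \<theta>' t z zs bs) \<in> borel_measurable borel"
        by (intro measurable_trans_dens[OF m(2) bs']) auto
      show "(\<lambda>z. trans_dens \<theta> t (v z) (\<chi> s. v (zs $ s)) bs * ?J z) \<in> borel_measurable borel"
        using mJ mv by (intro borel_measurable_times measurable_trans_dens[OF m(1) bs']) auto
      show "(\<integral>\<^sup>+ z. ennreal (trans_dens \<theta>' t z zs bs) \<partial>lborel) = 1"
        by (rule nn_integral_trans_dens[OF m(2) bs'])
      have mt: "(\<lambda>z. ennreal (trans_dens \<theta> t z (\<chi> s. v (zs $ s)) bs)) \<in> borel_measurable borel"
        by (intro measurable_compose[OF _ measurable_ennreal] measurable_trans_dens[OF m(1) bs']) auto
      show "(\<integral>\<^sup>+ z. ennreal (trans_dens \<theta> t (v z) (\<chi> s. v (zs $ s)) bs * ?J z) \<partial>lborel) = 1"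
        using nn_integral_change_of_variables[OF ev(1,4) _ mJ mt]
          nn_integral_trans_dens[OF m(1) bs', of t "\<chi> s. v (zs $ s)"]
        by (simp add: jacobian_def ennreal_mult less_imp_le[OF trans_dens_pos[OF m(1) bs']] mult.commute)
      show "trans_dens \<theta>' t z zs bs = trans_dens \<theta>' t z zs' bs"
        if "\<And>s. s < t \<Longrightarrow> zs $ s = zs' $ s"
        using that by (intro trans_dens_history[OF m(2) bs' bs']) auto
      show "trans_dens \<theta> t (v z) (\<chi> s. v (zs $ s)) bs * ?J z = trans_dens \<theta> t (v z) (\<chi> s. v (zs' $ s)) bs * ?J z"
        if "\<And>s. s < t \<Longrightarrow> zs $ s = zs' $ s"
      proof -
        have "trans_dens \<theta> t (v z) (\<chi> s. v (zs $ s)) bs = trans_dens \<theta> t (v z) (\<chi> s. v (zs' $ s)) bs"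
          using that by (intro trans_dens_history[OF m(1) bs' bs']) auto
        then show ?thesis by simp
      qed
      show "(\<Prod>t\<in>UNIV. trans_dens \<theta>' t (zs $ t) zs bs)
          = (\<Prod>t\<in>UNIV. trans_dens \<theta> t (v (zs $ t)) (\<chi> s. v (zs $ s)) bs * ?J (zs $ t))"
        unfolding v_def by (rule joint_dens_eq[OF m C2 r law[OF bs] bs])
    qed
    moreover have "trans_dens \<theta>' t z zs as = trans_dens \<theta>' t z zs bs"
      by (rule trans_dens_history[OF m(2) as bs']) (auto simp: bs_def)
    moreover have "trans_dens \<theta> t (v z) (\<chi> s. v (zs $ s)) as = trans_dens \<theta> t (v z) (\<chi> s. v (zs $ s)) bs"
      by (rule trans_dens_history[OF m(1) as bs']) (auto simp: bs_def)
    ultimately show ?thesis by simp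
  qed
  then show ?thesis using r by (simp add: diff_equiv_def Let_def v_def)
qed

section \<open>Derivatives of the log transition density\<close>

text \<open>Each factor has its own C-2 extension on its own open set. This set is cut down to where
  the extension is positive, so that the logarithm exists, and pulled back to the full latent
  vector; the intersection over the finitely many \<open>i\<close> is still open.\<close>

lemma Ck_on_ln_trans_dens:
  fixes \<theta> :: "('x::finite, 'z::finite, 'a::finite, 't::{finite,linorder}) glm"
  assumes m: "graphical_latent_model A \<theta>" and C2: "C2_factors A \<theta>"
  shows "Ck_on 2 (UNIV \<times> UNIV \<times> aux_hist A t) (\<lambda>(z, zs, as). ln (trans_dens \<theta> t z zs as))"
proof -
  let ?S = "UNIV \<times> UNIV \<times> aux_hist A t :: (real \<times> (real^'z^'t::_) \<times> (real^'a^'t::_)) set"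
  have "\<forall>i. \<exists>F U. open U \<and> ?S \<subseteq> U \<and> Ck_open 2 U F \<and> (\<forall>x\<in>?S. F x = (\<lambda>(y, zs, as). dens \<theta> t i y zs as) x)"
  proof
    fix i
    have "Ck_on 2 ?S (\<lambda>(y, zs, as). dens \<theta> t i y zs as)"
      using C2 by (simp add: C2_factors_def)
    then show "\<exists>F U. open U \<and> ?S \<subseteq> U \<and> Ck_open 2 U F \<and> (\<forall>x\<in>?S. F x = (\<lambda>(y, zs, as). dens \<theta> t i y zs as) x)"
      unfolding Ck_on_def Ck_extension_def by blast
  qed
  then obtain F U where U: "\<And>i. open (U i)" "\<And>i. ?S \<subseteq> U i" "\<And>i. Ck_open 2 (U i) (F i)"
    and F: "\<And>i y zs as. as \<in> aux_hist A t \<Longrightarrow> F i (y, zs, as) = dens \<theta> t i y zs as"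
    by (metis (no_types, lifting) SigmaI UNIV_I case_prod_conv)
  define V where "V i = {x \<in> U i. F i x > 0}" for i
  have oV: "open (V i)" for i
  proof -
    have "open (F i -` {0<..} \<inter> U i)"
      using continuous_on_open_vimage[OF U(1)] Ck_open_imp_continuous_on[OF U(3)] open_greaterThan by blast
    moreover have "F i -` {0<..} \<inter> U i = V i" by (auto simp: V_def)
    ultimately show ?thesis by simp
  qed
  define L where "L i = (\<lambda>(z :: real^'z, zs :: real^'z^'t::_, as :: real^'a^'t::_). (z $ i, zs, as))" for i
  have lin: "linear (L i)" for i
    by (auto simp: L_def linear_iff)
  define W where "W = (\<Inter>i. L i -` V i)"
  have oLV: "open (L i -` V i)" for i
    using lin[of i] oV[of i] by (intro open_vimage linear_continuous_on) (auto simp: linear_linear)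
  have oW: "open W" unfolding W_def using oLV by auto
  have "Ck_open 2 (L i -` V i) (\<lambda>x. ln (F i (L i x)))" for i
  proof -
    have "Ck_open 2 (V i) (F i)"
      using U(3) by (rule Ck_open_subset) (auto simp: V_def)
    then have "Ck_open 2 (V i) (\<lambda>x. ln (F i x))"
      using oV by (rule Ck_open_2_ln) (auto simp: V_def)
    then show ?thesis using oV lin by (rule Ck_open_2_linear_compose)
  qed
  then have "Ck_open 2 W (\<lambda>x. ln (F i (L i x)))" for i
    by (rule Ck_open_subset) (auto simp: W_def)
  then have "Ck_open 2 W (\<lambda>x. \<Sum>i\<in>UNIV. ln (F i (L i x)))"
    using oW by (intro Ck_open_2_sum)
  moreover have "UNIV \<times> UNIV \<times> aux_hist A t \<subseteq> W"
    using U(2) dens_pos[OF m] F by (fastforce simp: W_def V_def L_def)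
  moreover have "(\<Sum>i\<in>UNIV. ln (F i (L i (z, zs, as)))) = ln (trans_dens \<theta> t z zs as)"
    if "as \<in> aux_hist A t" for z zs as
    unfolding trans_dens_def using dens_pos[OF m that]
    by (subst ln_prod) (auto simp: L_def F[OF that] less_imp_neq[symmetric])
  ultimately show ?thesis
    using oW unfolding Ck_on_def Ck_extension_def by (intro exI[of _ "\<lambda>x. \<Sum>i\<in>UNIV. ln (F i (L i x))"]) auto
qed

text \<open>Columns up to \<open>t\<close> are approximated from the interior of \<open>A\<close>,
  while later columns are unconstrained and stay fixed. Derivative identities at interior histories
  thus extend to boundary ones by continuity.\<close>

lemma aux_hist_subset_closure_interior:
  fixes A :: "(real^'a::finite) set"
  assumes "regular_closed A"
  shows "aux_hist A (t :: 't::{finite,linorder}) \<subseteq> closure (interior (aux_hist A t))"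
proof
  fix as assume as: "as \<in> aux_hist A t"
  let ?I = "{bs :: real^'a^'t::_. \<forall>s\<le>t. bs $ s \<in> interior A}"
  have "open ?I"
  proof -
    have "?I = (\<Inter>s\<in>{..t}. (\<lambda>bs. bs $ s) -` interior A)" by auto
    moreover have "open ((\<lambda>bs :: real^'a^'t::_. bs $ s) -` interior A)" for s
      by (intro open_vimage continuous_intros) auto
    ultimately show ?thesis by auto
  qed
  moreover have "?I \<subseteq> aux_hist A t" using interior_subset by (auto simp: aux_hist_def)
  ultimately have I: "?I \<subseteq> interior (aux_hist A t)" by (rule interior_maximal[rotated])
  have "\<forall>s. \<exists>X. \<forall>n. (s \<le> t \<longrightarrow> X n \<in> interior A) \<and> (X \<longlonglongrightarrow> as $ s)"
  proof
    fix s
    show "\<exists>X. \<forall>n. (s \<le> t \<longrightarrow> X n \<in> interior A) \<and> (X \<longlonglongrightarrow> as $ s)"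
    proof (cases "s \<le> t")
      case True
      then have "as $ s \<in> closure (interior A)"
        using as assms by (auto simp: aux_hist_def regular_closed_def)
      then show ?thesis by (auto simp: closure_sequential)
    next
      case False
      then show ?thesis by (intro exI[of _ "\<lambda>_. as $ s"]) simp
    qed
  qed
  then obtain X where X: "\<And>s n. s \<le> t \<Longrightarrow> X s n \<in> interior A" "\<And>s. X s \<longlonglongrightarrow> as $ s"
    by metis
  have "(\<lambda>n. \<chi> s. X s n) \<longlonglongrightarrow> (\<chi> s. as $ s)"
    by (intro tendsto_vec_lambda X(2))
  then have "(\<lambda>n. \<chi> s. X s n) \<longlonglongrightarrow> as" by simp
  moreover have "(\<chi> s. X s n) \<in> interior (aux_hist A t)" for n
    using I X(1) by auto
  ultimately show "as \<in> closure (interior (aux_hist A t))"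
    unfolding closure_sequential
    by (intro exI[of _ "\<lambda>n. \<chi> s. X s n"]) blast
qed

text \<open>
  Subtracting the change-of-variables identity for the log densities at two values of the auxiliary
  variables removes the Jacobian term, which is only continuous. The difference does not depend on
  \<open>z $ j\<close> if the two values differ in the auxiliary variable \<open>l\<close> only and \<open>l\<close> does not influence
  \<open>j\<close>. Hence only one derivative in \<open>z\<close> is taken before that in the auxiliary variable.
\<close>

lemma hessian_orthogonal:
  fixes \<theta> \<theta>' :: "('x::finite, 'z::finite, 'a::finite, 't::{finite,linorder}) glm"
  assumes reg: "regular_closed A" and m: "graphical_latent_model A \<theta>" "graphical_latent_model A \<theta>'"
    and C2: "C2_factors A \<theta>" and de: "diff_equiv A \<theta> \<theta>'"
    and G: "Ga \<theta>' $ j $ l = 0" and as: "as \<in> aux_hist A t" and s: "s \<le> t"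
  defines "v \<equiv> entanglement_map \<theta> \<theta>'"
  shows "frechet_derivative v (at z) (axis j 1) \<bullet> column l (hessian_za A \<theta> t s (v z) zs as) = 0"
proof -
  let ?S = "UNIV \<times> UNIV \<times> aux_hist A t :: ((real^'z) \<times> (real^'z^'t::_) \<times> (real^'a^'t::_)) set"
  let ?L = "\<lambda>(z, zs, as). ln (trans_dens \<theta> t z zs as)"
  \<comment> \<open>This is the very extension chosen inside \<open>second_deriv_on\<close>, so its
    mixed derivatives are the Hessian entries by definition, at boundary points too.\<close>
  define F where "F = (SOME F. Ck_extension 2 ?S ?L F)"
  have "Ck_extension 2 ?S ?L F"
    unfolding F_def by (rule someI_ex[OF Ck_on_ln_trans_dens[OF m(1) C2, of t, unfolded Ck_on_def]])
  then obtain U where U: "open U" "?S \<subseteq> U" "Ck_open 2 U F"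
    and F: "\<And>z zs as. as \<in> aux_hist A t \<Longrightarrow> F (z, zs, as) = ln (trans_dens \<theta> t z zs as)"
    by (auto simp: Ck_extension_def)
  note dF = Ck_open_2E(1)[OF U(3)] and dF2 = Ck_open_2E(2)[OF U(3)] and cF2 = Ck_open_2E(3)[OF U(3)]
  have r: "range (mixing \<theta>) = range (mixing \<theta>')" using de by (simp add: diff_equiv_def)
  note ev = entanglement_map_facts[OF m r, folded v_def]
  define bi :: "'z \<Rightarrow> (real^'z) \<times> (real^'z^'t::_) \<times> (real^'a^'t::_)" where "bi i = (axis i 1, 0, 0)" for i
  define e :: "real^'a^'t::_" where "e = axis s (axis l 1)"
  define w :: "(real^'z) \<times> (real^'z^'t::_) \<times> (real^'a^'t::_)" where "w = (0, 0, e)"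
  have bi: "bi i \<in> Basis" for i by (simp add: bi_def Basis_prod_def zero_prod_def image_iff)
  have wB: "w \<in> Basis" by (simp add: w_def e_def Basis_prod_def zero_prod_def image_iff)
  define g where "g i x = frechet_derivative F (at x) (bi i)" for i x
  define d where "d = frechet_derivative v (at z) (axis j 1)"
  define H where "H i x = frechet_derivative (g i) (at x) w" for i x
  have hess: "hessian_za A \<theta> t s y zs bs $ i $ l = H i (y, zs, bs)" for y zs bs i
    by (simp add: hessian_za_def second_deriv_on_def F_def[symmetric] Let_def H_def g_def[abs_def] bi_def w_def e_def)
  \<comment> \<open>The Hessian is taken at an arbitrary history of the first model; bijectivity of
    \<open>v\<close> makes it the image of a history of the second.\<close>
  obtain zs0 where zs0: "zs = (\<chi> s. v (zs0 $ s))"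
  proof
    show "zs = (\<chi> s. v ((\<chi> s. inv v (zs $ s)) $ s))"
      using ev(1) by (simp add: vec_eq_iff bij_def surj_f_inv_f)
  qed
  have diff: "(\<Sum>i\<in>UNIV. d $ i * g i (v z, zs, bs)) = (\<Sum>i\<in>UNIV. d $ i * g i (v z, zs, bs'))"
    if bs: "bs \<in> aux_hist A t" "bs' \<in> aux_hist A t"
      and eq: "\<And>s k. k \<noteq> l \<Longrightarrow> bs $ s $ k = bs' $ s $ k" for bs bs'
  proof -
    have D: "((\<lambda>r. ln (trans_dens \<theta> t (v (z + r *\<^sub>R axis j 1)) zs cs)) has_real_derivative
        (\<Sum>i\<in>UNIV. d $ i * g i (v z, zs, cs))) (at 0)"
      if cs: "cs \<in> aux_hist A t" for cs
    proof -
      let ?F' = "frechet_derivative F (at (v z, zs, cs))"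
      have F': "(F has_derivative ?F') (at (v (z + 0 *\<^sub>R axis j 1), zs, cs))"
        using dF[of "(v z, zs, cs)"] U(2) cs by auto
      have v': "((\<lambda>r. z + r *\<^sub>R axis j 1) has_derivative (\<lambda>r. r *\<^sub>R axis j 1)) (at 0)"
        by (auto intro!: derivative_eq_intros)
      have "(v has_derivative frechet_derivative v (at z)) (at (z + 0 *\<^sub>R axis j 1))"
        using ev(4)[of z] by simp
      from diff_chain_at[OF v' this]
      have "((\<lambda>r. (v (z + r *\<^sub>R axis j 1), zs, cs)) has_derivative
          (\<lambda>r. (frechet_derivative v (at z) (r *\<^sub>R axis j 1), 0, 0))) (at 0)"
        by (auto intro!: has_derivative_Pair simp: o_def)
      from diff_chain_at[OF this F']
      have "((\<lambda>r. F (v (z + r *\<^sub>R axis j 1), zs, cs)) has_derivative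
          (\<lambda>r. ?F' (frechet_derivative v (at z) (r *\<^sub>R axis j 1), 0, 0))) (at 0)"
        by (simp add: o_def)
      moreover have "?F' (frechet_derivative v (at z) (r *\<^sub>R axis j 1), 0, 0)
          = (\<Sum>i\<in>UNIV. d $ i * g i (v z, zs, cs)) * r" for r
      proof -
        have lF: "linear ?F'" using F' by (rule has_derivative_linear)
        have lv: "linear (frechet_derivative v (at z))" using ev(4) by (rule has_derivative_linear)
        have "(frechet_derivative v (at z) (r *\<^sub>R axis j 1), 0, 0) = r *\<^sub>R (\<Sum>i\<in>UNIV. d $ i *\<^sub>R bi i)"
        proof -
          have "(\<Sum>i\<in>UNIV. d $ i *\<^sub>R bi i) = (\<Sum>i\<in>UNIV. d $ i *\<^sub>R axis i 1, 0, 0)"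
            by (auto simp: bi_def prod_eq_iff fst_sum snd_sum)
          also have "(\<Sum>i\<in>UNIV. d $ i *\<^sub>R axis i 1) = d"
            using basis_expansion[of d] by (simp add: scalar_mult_eq_scaleR)
          finally show ?thesis by (simp add: d_def linear_scale[OF lv])
        qed
        then show ?thesis
          by (simp add: linear_scale[OF lF] linear_sum[OF lF] g_def mult.commute sum_distrib_left)
      qed
      ultimately show ?thesis
        unfolding has_field_derivative_def F[OF cs] by simp
    qed
    let ?p = "\<lambda>cs r. ln (trans_dens \<theta> t (v (z + r *\<^sub>R axis j 1)) zs cs)"
    have "?p bs r - ?p bs' r = ?p bs 0 - ?p bs' 0" for r
    proof -
      let ?J = "\<lambda>z. \<bar>det (jacobian v (at z))\<bar>"
      let ?pi = "\<lambda>cs y i. ln (dens \<theta>' t i (y $ i) zs0 cs)"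
      have p': "ln (trans_dens \<theta> t (v y) zs cs) = (\<Sum>i\<in>UNIV. ?pi cs y i) - ln (?J y)"
        if cs: "cs \<in> aux_hist A t" for cs y
      proof -
        have "trans_dens \<theta>' t y zs0 cs = trans_dens \<theta> t (v y) zs cs * ?J y"
          using de cs by (simp add: diff_equiv_def Let_def v_def zs0)
        then have "ln (trans_dens \<theta>' t y zs0 cs) = ln (trans_dens \<theta> t (v y) zs cs) + ln (?J y)"
          using trans_dens_pos[OF m(1) cs, of "v y" zs] ev(7)[of y] by (simp add: ln_mult_pos)
        moreover have "ln (trans_dens \<theta>' t y zs0 cs) = (\<Sum>i\<in>UNIV. ?pi cs y i)"
          unfolding trans_dens_def using dens_pos[OF m(2) cs]
          by (subst ln_prod) (auto simp: less_imp_neq[symmetric])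
        ultimately show ?thesis by simp
      qed
      \<comment> \<open>A move along \<open>axis j 1\<close> leaves the factors with
        \<open>i \<noteq> j\<close> unchanged. Factor \<open>j\<close> has equal values at
        \<open>bs\<close> and \<open>bs'\<close>, which differ in row \<open>l\<close> only, so its
        difference is 0 throughout.\<close>
      have c: "?pi bs (z + r *\<^sub>R axis j 1) i - ?pi bs' (z + r *\<^sub>R axis j 1) i = ?pi bs z i - ?pi bs' z i" for i
      proof (cases "i = j")
        case True
        have "dens \<theta>' t j y zs0 bs = dens \<theta>' t j y zs0 bs'" for y
          using eq G by (intro dens_history[OF m(2) bs]) (auto, metis zero_neq_one)
        then show ?thesis using True by simp
      qed (simp add: axis_def)
      have "?p bs r - ?p bs' r = (\<Sum>i\<in>UNIV. ?pi bs (z + r *\<^sub>R axis j 1) i - ?pi bs' (z + r *\<^sub>R axis j 1) i)"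
        by (simp add: p' bs sum_subtractf)
      also have "\<dots> = (\<Sum>i\<in>UNIV. ?pi bs z i - ?pi bs' z i)" by (simp only: c)
      also have "\<dots> = ?p bs 0 - ?p bs' 0" by (simp add: p' bs sum_subtractf)
      finally show ?thesis .
    qed
    then have "((\<lambda>r. ?p bs r - ?p bs' r) has_real_derivative 0) (at 0)"
      by (simp add: fun_eq_iff)
    moreover have "((\<lambda>r. ?p bs r - ?p bs' r) has_real_derivative
        (\<Sum>i\<in>UNIV. d $ i * g i (v z, zs, bs)) - (\<Sum>i\<in>UNIV. d $ i * g i (v z, zs, bs'))) (at 0)"
      by (intro DERIV_diff D bs)
    ultimately show ?thesis using DERIV_unique by fastforce
  qed
  \<comment> \<open>From an interior history a small move along \<open>e\<close> stays admissible,
    so \<open>diff\<close> makes the sum locally constant in that direction and its derivative along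
    \<open>e\<close> is 0.\<close>
  have int: "(\<Sum>i\<in>UNIV. d $ i * H i (v z, zs, bs)) = 0" if bs: "bs \<in> interior (aux_hist A t)" for bs
  proof -
    have bsA: "bs \<in> aux_hist A t" using bs interior_subset by blast
    have "((\<lambda>r. bs + r *\<^sub>R e) \<longlongrightarrow> bs + 0 *\<^sub>R e) (at 0)"
      by (intro tendsto_intros)
    then have ev_in: "\<forall>\<^sub>F r in at 0. bs + r *\<^sub>R e \<in> interior (aux_hist A t)"
      using topological_tendstoD[of "\<lambda>r. bs + r *\<^sub>R e" _ "at 0" "interior (aux_hist A t)"] bs by simp
    let ?k = "\<lambda>r. \<Sum>i\<in>UNIV. d $ i * g i (v z, zs, bs + r *\<^sub>R e)"
    have "\<forall>\<^sub>F r in at 0. ?k r = ?k 0"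
      using ev_in
    proof eventually_elim
      case (elim r)
      then have "bs + r *\<^sub>R e \<in> aux_hist A t" using interior_subset by blast
      then show ?case
        using bsA by (intro diff) (auto simp: e_def axis_def)
    qed
    then have "(?k has_real_derivative 0) (at 0)"
      by (subst DERIV_cong_ev[OF refl _ refl, of _ "\<lambda>_. ?k 0"]) (auto simp: eventually_nhds_conv_at)
    moreover have "(?k has_real_derivative (\<Sum>i\<in>UNIV. d $ i * H i (v z, zs, bs))) (at 0)"
    proof (intro DERIV_sum DERIV_cmult)
      fix i
      have G': "(g i has_derivative frechet_derivative (g i) (at (v z, zs, bs))) (at (v z, zs, bs + 0 *\<^sub>R e))"
        using dF2[OF _ bi, of "(v z, zs, bs)" i] U(2) bsA by (auto simp: g_def[abs_def])
      have "((\<lambda>r. (v z, zs, bs + r *\<^sub>R e)) has_derivative (\<lambda>r. r *\<^sub>R w)) (at 0)"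
        unfolding w_def by (auto intro!: derivative_eq_intros)
      from diff_chain_at[OF this G']
      show "((\<lambda>r. g i (v z, zs, bs + r *\<^sub>R e)) has_real_derivative H i (v z, zs, bs)) (at 0)"
        by (simp add: has_field_derivative_def o_def H_def linear_scale[OF has_derivative_linear[OF G']]
            mult_commute_abs)
    qed
    ultimately show ?thesis by (rule DERIV_unique[symmetric])
  qed
  \<comment> \<open>Boundary histories are reached by continuity: the second derivatives of the
    extension are continuous on \<open>U\<close>, and \<open>aux_hist A t\<close> is the closure of
    its interior.\<close>
  have "continuous_on (aux_hist A t) (\<lambda>bs. \<Sum>i\<in>UNIV. d $ i * H i (v z, zs, bs))"
  proof (intro continuous_intros)
    fix i
    have "continuous_on U (H i)"
      using cF2[OF bi wB] by (simp add: H_def[abs_def] g_def[abs_def])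
    then show "continuous_on (aux_hist A t) (\<lambda>bs. H i (v z, zs, bs))"
      by (rule continuous_on_compose2) (use U(2) in \<open>auto intro!: continuous_intros\<close>)
  qed
  moreover have "aux_hist A t \<subseteq> closure (interior (aux_hist A t))"
    using reg by (rule aux_hist_subset_closure_interior)
  moreover have "closed (aux_hist A t)"
  proof -
    have "closed A" using reg by (metis closed_closure regular_closed_def)
    then have "closed (\<Inter>s\<in>{..t}. (\<lambda>as :: real^'a^'t::_. as $ s) -` A)"
      by (intro closed_INT ballI closed_vimage continuous_intros)
    moreover have "(\<Inter>s\<in>{..t}. (\<lambda>as :: real^'a^'t::_. as $ s) -` A) = aux_hist A t"
      by (auto simp: aux_hist_def)
    ultimately show ?thesis by simp
  qed
  then have "closure (interior (aux_hist A t)) = aux_hist A t"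
    using calculation(2) by (meson closure_minimal interior_subset subset_antisym)
  ultimately have "(\<Sum>i\<in>UNIV. d $ i * H i (v z, zs, as)) = 0"
    using continuous_constant_on_closure[of "interior (aux_hist A t)" "\<lambda>bs. \<Sum>i\<in>UNIV. d $ i * H i (v z, zs, bs)" 0 as]
      int as by simp
  then show ?thesis
    by (simp add: inner_vec_def column_def hess d_def)
qed

section \<open>Consistency\<close>

lemma entanglement_derivative_zero:
  fixes \<theta> \<theta>' :: "('x::finite, 'z::finite, 'a::finite, 't::{finite,linorder}) glm"
  assumes reg: "regular_closed A" and m: "graphical_latent_model A \<theta>" "graphical_latent_model A \<theta>'"
    and C2: "C2_factors A \<theta>" and de: "diff_equiv A \<theta> \<theta>'" and suff: "sufficient_influence A \<theta>"
    and G: "Ga \<theta> $ i $ l = 1" and G': "Ga \<theta>' $ j $ l = 0"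
  defines "v \<equiv> entanglement_map \<theta> \<theta>'"
  shows "frechet_derivative v (at z) (axis j 1) $ i = 0"
proof -
  have r: "range (mixing \<theta>) = range (mixing \<theta>')" using de by (simp add: diff_equiv_def)
  note ev = entanglement_map_facts[OF m r, folded v_def]
  have vi: "v (inv v y) = y" for y using ev(1) by (simp add: bij_def surj_f_inv_f)
  \<comment> \<open>The Hessian is evaluated at \<open>v z\<close>, so the exceptional null set of
    sufficient influence lies among the values \<open>y = v z\<close>. With \<open>y\<close> as the
    variable, no null set has to be transported through \<open>v\<close>.\<close>
  define \<phi> where "\<phi> y = frechet_derivative v (at (inv v y)) (axis j 1) $ i" for y
  have \<phi>: "\<phi> y = jacobian v (at (inv v y)) $ i $ j" for y
    by (simp add: \<phi>_def jacobian_def matrix_def)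
  have "continuous_on UNIV \<phi>"
    unfolding \<phi>[abs_def]
    by (rule continuous_on_compose2[OF ev(5) Ck_open_imp_continuous_on[OF ev(3)]]) simp
  then have "open {y. \<phi> y \<noteq> 0}" by (intro open_Collect_neq continuous_on_const)
  moreover have "AE y in lebesgue. y \<notin> {y. \<phi> y \<noteq> 0}"
    using suff unfolding sufficient_influence_def
  proof eventually_elim
    case (elim y)
    then obtain t s zs as where in_hist: "\<forall>r\<in>{1..card (Ch_a \<theta> l)}. s r \<le> t r \<and> as r \<in> aux_hist A (t r)"
      and span: "span ((\<lambda>r. column l (hessian_za A \<theta> (t r) (s r) y (zs r) (as r)))
          ` {1..card (Ch_a \<theta> l)}) = coord_subspace (Ch_a \<theta> l)"
      by blast
    let ?d = "frechet_derivative v (at (inv v y)) (axis j 1)"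
    have "axis i 1 \<in> coord_subspace (Ch_a \<theta> l)"
      using G by (auto simp: coord_subspace_def Ch_a_def axis_def)
    then have "axis i 1 \<in> span ((\<lambda>r. column l (hessian_za A \<theta> (t r) (s r) y (zs r) (as r)))
          ` {1..card (Ch_a \<theta> l)})" by (simp only: span)
    then have "orthogonal ?d (axis i 1)"
    proof (rule orthogonal_to_span)
      fix x assume "x \<in> (\<lambda>r. column l (hessian_za A \<theta> (t r) (s r) y (zs r) (as r))) ` {1..card (Ch_a \<theta> l)}"
      then obtain r where r: "r \<in> {1..card (Ch_a \<theta> l)}"
        and x: "x = column l (hessian_za A \<theta> (t r) (s r) (v (inv v y)) (zs r) (as r))"
        by (auto simp: vi)
      show "orthogonal ?d x"
        unfolding x orthogonal_def v_def
        using in_hist r by (intro hessian_orthogonal[OF reg m C2 de G']) auto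
    qed
    then show ?case by (simp add: \<phi>_def orthogonal_def inner_axis)
  qed
  ultimately have "{y. \<phi> y \<noteq> 0} = {}" by (rule open_empty_if_AE_not_in)
  then have "\<phi> (v z) = 0" by blast
  then show ?thesis using ev(1) by (simp add: \<phi>_def bij_def)
qed

theorem theorem1:
  fixes A :: "(real^'a::finite) set"
    and \<sigma>2 :: real
    and \<theta> \<theta>' :: "('x::finite, 'z::finite, 'a, 't::{finite,linorder}) glm"
  assumes "CARD('z) \<le> CARD('x)"
    and "\<sigma>2 \<ge> 0"
    and "A \<noteq> {}"
    and "regular_closed A"
    and "graphical_latent_model A \<theta>"
    and "graphical_latent_model A \<theta>'"
    and "C2_factors A \<theta>"
    and "C2_factors A \<theta>'"
    and "obs_equiv A \<sigma>2 \<theta> \<theta>'"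
    and "sufficient_influence A \<theta>"
  shows "(\<exists>P. permutation_matrix P \<and> pattern_le (P ** Ga \<theta>) (Ga \<theta>')) \<and>
         (l0_norm (Ga \<theta>') \<le> l0_norm (Ga \<theta>) \<longrightarrow> a_consistent A \<theta> \<theta>')"
proof -
  note m = assms(5,6)
  have de: "diff_equiv A \<theta> \<theta>'"
    by (rule obs_equiv_imp_diff_equiv[OF assms(3,5-9)])
  have r: "range (mixing \<theta>) = range (mixing \<theta>')" using de by (simp add: diff_equiv_def)
  define v where "v = entanglement_map \<theta> \<theta>'"
  note ev = entanglement_map_facts[OF m r, folded v_def]
  note zero = entanglement_derivative_zero[OF assms(4) m assms(7) de assms(10), folded v_def]
  have bin: "Ga \<theta> $ i $ l = 0 \<or> Ga \<theta> $ i $ l = 1" "Ga \<theta>' $ i $ l = 0 \<or> Ga \<theta>' $ i $ l = 1" for i l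
    using m by (auto simp: graphical_latent_model_def binary_matrix_def)
  obtain p where p: "bij p" and p_nz: "\<And>j. jacobian v (at 0) $ p j $ j \<noteq> 0"
    using det_nonzero_obtains_permutation[OF ev(7)[of 0]] by blast
  have pi: "inv p (p j) = j" "p (inv p i) = i" "j = inv p i \<longleftrightarrow> i = p j" for i j
    using p by (auto simp: bij_def surj_f_inv_f)
  have sub: "Ga \<theta>' $ j $ l \<noteq> 0" if "Ga \<theta> $ p j $ l \<noteq> 0" for j l
    using zero[of "p j" l j 0] p_nz[of j] bin(1)[of "p j" l] that
    by (auto simp: jacobian_def matrix_def)
  \<comment> \<open>With the inverse of \<open>p\<close> here, row \<open>j\<close> of
    \<open>P ** Ga \<theta>\<close> is row \<open>p j\<close> of \<open>Ga \<theta>\<close>,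
    matching the nonzero entries \<open>(p j, j)\<close>.\<close>
  define P :: "real^'z^'z" where "P = (\<chi> i k. if i = inv p k then 1 else 0)"
  have perm: "permutation_matrix P"
    unfolding permutation_matrix_def P_def using bij_imp_bij_inv[OF p] by blast
  have PG: "(P ** Ga \<theta>) $ j $ l = Ga \<theta> $ p j $ l" for j l
    by (simp add: P_def matrix_matrix_mult_def pi(3) if_distrib[of "\<lambda>x. x * _"] cong: if_cong)
  have Pv: "(P *v y) $ j = y $ p j" for y j
    by (simp add: P_def matrix_vector_mult_def pi(3) if_distrib[of "\<lambda>x. x * _"] cong: if_cong)
  have PTv: "(transpose P *v y) $ i = y $ inv p i" for y i
    by (simp add: P_def transpose_def matrix_vector_mult_def if_distrib[of "\<lambda>x. x * _"] cong: if_cong)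
  have P_inv: "P *v (transpose P *v y) = y" "transpose P *v (P *v y) = y" for y
    by (simp_all only: vec_eq_iff Pv PTv pi) simp_all
  have le: "pattern_le (P ** Ga \<theta>) (Ga \<theta>')"
    unfolding pattern_le_def PG using sub by blast
  have "a_consistent A \<theta> \<theta>'" if l0: "l0_norm (Ga \<theta>') \<le> l0_norm (Ga \<theta>)"
  proof -
    let ?supp = "\<lambda>M :: real^'a^'z. {(i, l). M $ i $ l \<noteq> 0}"
    \<comment> \<open>A permutation of rows keeps the number of edges, so the sparsity bound makes
      the larger of two nested finite supports no bigger than the smaller.\<close>
    have "bij_betw (\<lambda>(j, l). (p j, l)) (?supp (P ** Ga \<theta>)) (?supp (Ga \<theta>))"
      by (rule bij_betw_byWitness[where f' = "\<lambda>(i, l). (inv p i, l)"]) (auto simp: PG pi)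
    then have "card (?supp (Ga \<theta>')) \<le> card (?supp (P ** Ga \<theta>))"
      using l0 by (simp add: l0_norm_def bij_betw_same_card)
    moreover have "?supp (P ** Ga \<theta>) \<subseteq> ?supp (Ga \<theta>')"
      using le by (auto simp: pattern_le_def)
    ultimately have "?supp (P ** Ga \<theta>) = ?supp (Ga \<theta>')"
      by (intro card_seteq) auto
    then have supp: "(P ** Ga \<theta>) $ j $ l \<noteq> 0 \<longleftrightarrow> Ga \<theta>' $ j $ l \<noteq> 0" for j l by blast
    have GaP: "Ga \<theta>' $ j $ l = Ga \<theta> $ p j $ l" for j l
      using supp[of j l] bin(1)[of "p j" l] bin(2)[of j l] by (auto simp: PG)
    define c where "c = v \<circ> (\<lambda>y. P *v y)"
    have linP: "linear (\<lambda>y. P *v y)" "linear (\<lambda>y. transpose P *v y)"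
      by (rule matrix_vector_mul_linear)+
    have bP: "bij (\<lambda>y. P *v y)" by (rule o_bij[of "\<lambda>y. transpose P *v y"]) (simp_all only: fun_eq_iff o_apply id_apply P_inv simp_thms)
    have inv_P: "inv (\<lambda>y. P *v y) = (\<lambda>y. transpose P *v y)"
      by (rule inv_equality) (simp_all only: P_inv)
    have "diffeomorphism c"
    proof -
      have "Ck_open 1 UNIV c"
        unfolding c_def o_def by (rule Ck_open_1_compose[OF ev(2) Ck_open_1_linear[OF linP(1)]]) auto
      moreover have "inv c = (\<lambda>y. transpose P *v (inv v y))"
        unfolding c_def o_inv_distrib[OF ev(1) bP] inv_P by (rule o_def)
      moreover have "Ck_open 1 UNIV (\<lambda>y. transpose P *v (inv v y))"
        by (rule Ck_open_1_compose[OF Ck_open_1_linear[OF linP(2)] ev(3)]) auto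
      moreover have "bij c" unfolding c_def by (intro bij_comp bP ev(1))
      ultimately show ?thesis by (simp only: diffeomorphism_def Ck_on_UNIV_iff)
    qed
    moreover have "fun_preserving (Ga \<theta>) c"
    proof -
      \<comment> \<open>Argument \<open>k\<close> of \<open>c\<close> is argument
        \<open>inv p k\<close> of \<open>v\<close>, and \<open>l\<close> influences
        \<open>inv p k\<close> in the second model exactly when it influences \<open>k\<close> in
        the first. The forced zeros of the Jacobian of \<open>v\<close> therefore apply.\<close>
      have "independent_of_arg (\<lambda>x. c x $ i) k" if "Ga \<theta> $ i $ l \<noteq> 0" "Ga \<theta> $ k $ l = 0" for i k l
      proof -
        have "Ga \<theta> $ i $ l = 1" "Ga \<theta>' $ inv p k $ l = 0"
          using that bin(1)[of i l] by (auto simp: GaP pi)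
        then have "independent_of_arg (\<lambda>x. v x $ i) (inv p k)"
          by (intro independent_of_arg_if_derivative_zero[OF ev(4)] zero)
        then show ?thesis
          unfolding independent_of_arg_def c_def by (simp add: Pv) (metis Pv pi(1))
      qed
      \<comment> \<open>Entry \<open>(k, l)\<close> is the sum over \<open>i\<close> of
        \<open>dependency_graph c $ i $ k * M $ i $ l\<close>. Each term is 0: if \<open>l\<close>
        does not influence \<open>i\<close>, the pattern annihilates \<open>M $ i $ l\<close>; if it
        does, component \<open>i\<close> of \<open>c\<close> ignores argument
        \<open>k\<close>.\<close>
      then have "(transpose (dependency_graph c) ** M) $ k $ l = 0"
        if "\<forall>i j. Ga \<theta> $ i $ j = 0 \<longrightarrow> M $ i $ j = 0" "Ga \<theta> $ k $ l = 0" for M :: "real^'a^'z" and k l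
        using that unfolding matrix_matrix_mult_def transpose_def dependency_graph_def
        by (auto intro!: sum.neutral) blast
      then show ?thesis
        by (auto simp: fun_preserving_def matrix_preserving_def matrices_with_pattern_def)
    qed
    moreover have "v = c \<circ> (\<lambda>z. transpose P *v z)"
      by (simp only: c_def fun_eq_iff o_apply P_inv simp_thms)
    moreover have "Ga \<theta>' = P ** Ga \<theta>" by (simp add: vec_eq_iff PG GaP)
    ultimately show ?thesis
      using perm de unfolding a_consistent_def v_def by blast
  qed
  then show ?thesis using perm le by blast
qed


end
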